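(* There exists an absolute constant $C > 0$ such that for any integers $1 \le m < n$ there exist a convex body $K \subset \mathbb{R}^n$ and a linear subspace $F \subset \mathbb{R}^n$ of dimension $m$ such that for any $x \in \mathbb{R}^n$ $$ \mathrm{vol}\big((K-K) \cap F\big) \ge C^m \, \psi^m(m,n) \cdot \mathrm{vol}\big(K \cap (F+x)\big), $$ where $$ \psi(m,n) = \min\left( \sqrt{\log\left( \frac{n}{m}+1 \right)}, \sqrt{m} \right). $$
   Context: A convex body in $\mathbb{R}^n$ is a compact convex set with nonempty interior. The difference body of $K$ is $K-K = \{ x-y \mid x,y \in K \}$. The symbol $\mathrm{vol}$ denotes volume in the relevant dimension; here it is $m$-dimensional Lebesgue measure on $F$ and on its translates $F+x$. An absolute constant is one that does not depend on $m$ or $n$ (nor on $K$, $F$, $x$). The logarithm is natural. *)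

theory Defs
  imports "HOL-Analysis.Analysis" "HOL-Analysis.Finite_Function_Topology"
begin

(* The dimension n is quantified inside the theorem (the absolute constant comes first), so it
   cannot be a type.  All the spaces R^n live in the single normed space of finitely supported
   real sequences, R^n being the sequences supported on {..<n}.  The library norm there is the
   l^1 norm; restricted to R^n it induces the usual topology, and only the topology is used
   (compactness and interior).  Lengths and volumes are Euclidean, via the inner product below. *)

definition Rn :: "nat \<Rightarrow> (nat \<Rightarrow>\<^sub>0 real) set" where
  "Rn n = {x. Poly_Mapping.keys x \<subseteq> {..<n}}"

definition dot :: "(nat \<Rightarrow>\<^sub>0 real) \<Rightarrow> (nat \<Rightarrow>\<^sub>0 real) \<Rightarrow> real" where
  "dot x y = (\<Sum>i\<in>Poly_Mapping.keys x. Poly_Mapping.lookup x i * Poly_Mapping.lookup y i)"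

(* The interior is taken relative to R^n, not in the ambient sequence space. *)

definition convex_body :: "nat \<Rightarrow> (nat \<Rightarrow>\<^sub>0 real) set \<Rightarrow> bool" where
  "convex_body n K \<longleftrightarrow>
     K \<subseteq> Rn n \<and> compact K \<and> convex K \<and> (top_of_set (Rn n)) interior_of K \<noteq> {}"

definition difference_body :: "(nat \<Rightarrow>\<^sub>0 real) set \<Rightarrow> (nat \<Rightarrow>\<^sub>0 real) set" where
  "difference_body K = {x - y | x y. x \<in> K \<and> y \<in> K}"

(* Only the first dim F members of the sequence b matter. *)

definition orthonormal_basis :: "(nat \<Rightarrow>\<^sub>0 real) set \<Rightarrow> (nat \<Rightarrow> (nat \<Rightarrow>\<^sub>0 real)) \<Rightarrow> bool" where
  "orthonormal_basis F b \<longleftrightarrow>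
     (\<forall>i<dim F. \<forall>j<dim F. dot (b i) (b j) = (if i = j then 1 else 0)) \<and> span (b ` {..<dim F}) = F"

(* vol F x A is the (dim F)-dimensional Lebesgue measure of A as a subset of the translate F + x
   of the finite-dimensional subspace F: the Lebesgue measure of the preimage of A under the
   isometry from R^(dim F) onto F + x given by an orthonormal basis of F.  By rotation and
   translation invariance of Lebesgue measure the value depends neither on the basis nor on
   the base point x of the translate. *)

definition vol :: "(nat \<Rightarrow>\<^sub>0 real) set \<Rightarrow> (nat \<Rightarrow>\<^sub>0 real) \<Rightarrow> (nat \<Rightarrow>\<^sub>0 real) set \<Rightarrow> real" where
  "vol F x A =
     (let b = (SOME b. orthonormal_basis F b);
          M = (\<Pi>\<^sub>M i\<in>{..<dim F}. (lborel :: real measure))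
      in measure M {t \<in> space M. (\<Sum>i<dim F. t i *\<^sub>R b i) + x \<in> A})"

definition \<psi> :: "nat \<Rightarrow> nat \<Rightarrow> real" where
  "\<psi> m n = min (sqrt (ln (real n / real m + 1))) (sqrt (real m))"

end

theory Submission
  imports Defs
begin

text \<open>Every fibre of the convex body below over \<open>F\<close> is a zonotope, the Minkowski sum of segments
  \<open>l q [- v q, v q]\<close> with \<open>l q \<ge> 0\<close> and \<open>\<Sum>q. l q \<le> 1\<close>, while the union of their difference
  bodies is \<open>2 conv {v q, - v q}\<close>. The \<open>v q\<close> run through the vertices of the cubes \<open>[- 1, 1]\<^sup>d\<close> over
  \<open>m / d\<close> blocks of \<open>d\<close> coordinates each, with \<open>d\<close> of order \<open>\<psi>\<^sup>2\<close>, so about \<open>(m / d) 2\<^sup>d \<le> n - m\<close> extra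
  dimensions suffice. Their convex hull contains a cube whose side is of order \<open>d / m\<close>. Steiner symmetrization in
  the coordinate directions shows that a convex body has at most the volume of the cross-polytope
  whose radius is the mean of its support function over the sign vectors. For a fibre this mean is at
  most \<open>sqrt d\<close>, which bounds its volume by \<open>(2 e sqrt d / m) ^ m\<close>; the quotient is of order
  \<open>(sqrt d) ^ m\<close>. If \<open>n < 5 m\<close>, a cube does.\<close>

section \<open>Lebesgue measure on finite products of lines\<close>

text \<open>Points of this space are \<open>undefined\<close> outside \<open>I\<close>, so maps into
  it are written with restricted abstractions.\<close>

abbreviation lebP :: "nat set \<Rightarrow> (nat \<Rightarrow> real) measure" where
  "lebP I \<equiv> \<Pi>\<^sub>M i\<in>I. (lborel :: real measure)"

text \<open>Affine substitution with Jacobian 1. The sign \<open>s\<close> covers translations and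
  point reflections at once; the Haar measure argument uses both.\<close>

lemma lborel_reflect_shift:
  fixes s a :: real
  assumes s: "s = 1 \<or> s = - 1" and B: "B \<in> sets borel"
  shows "emeasure lborel ((\<lambda>y. a + s * y) -` B) = emeasure lborel B"
proof -
  have "lborel = density (distr lborel borel (\<lambda>y. a + s * y)) (\<lambda>_. ennreal \<bar>s\<bar>)"
    using s by (intro lborel_real_affine) auto
  also have "\<dots> = distr lborel borel (\<lambda>y. a + s * y)"
    using s by (auto simp: density_1)
  finally have "emeasure lborel B = emeasure (distr lborel borel (\<lambda>y. a + s * y)) B"
    by (rule arg_cong[where f = "\<lambda>M. emeasure M B"])
  also have "\<dots> = emeasure lborel ((\<lambda>y. a + s * y) -` B)"
    using B by (subst emeasure_distr) auto
  finally show ?thesis by simp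
qed

text \<open>A product measure is determined by its values on boxes, and preimages of boxes are boxes
  factor by factor, so dimension one suffices.\<close>

lemma distr_lebP_reflect_shift:
  fixes s :: real
  assumes I: "finite I" and s: "s = 1 \<or> s = - 1"
  shows "distr (lebP I) (lebP I) (\<lambda>t. \<lambda>i\<in>I. a i + s * t i) = lebP I"
proof -
  interpret product_sigma_finite "\<lambda>_::nat. lborel :: real measure" by standard
  have meas: "(\<lambda>t. \<lambda>i\<in>I. a i + s * t i) \<in> measurable (lebP I) (lebP I)"
    by measurable
  show ?thesis
  proof (rule PiM_eqI)
    fix B :: "nat \<Rightarrow> real set" assume B: "\<And>i. i \<in> I \<Longrightarrow> B i \<in> sets lborel"
    have m1: "(\<lambda>y. a i + s * y) -` B i \<in> sets lborel" if "i \<in> I" for i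
    proof -
      have "(\<lambda>y. a i + s * y) -` B i \<inter> space lborel \<in> sets lborel"
        by (rule measurable_sets[of _ _ lborel]) (use B that in auto)
      then show ?thesis by simp
    qed
    have "emeasure (distr (lebP I) (lebP I) (\<lambda>t. \<lambda>i\<in>I. a i + s * t i)) (Pi\<^sub>E I B)
        = emeasure (lebP I) ((\<lambda>t. \<lambda>i\<in>I. a i + s * t i) -` Pi\<^sub>E I B \<inter> space (lebP I))"
      using B I by (intro emeasure_distr meas sets_PiM_I_finite) auto
    also have "(\<lambda>t. \<lambda>i\<in>I. a i + s * t i) -` Pi\<^sub>E I B \<inter> space (lebP I)
        = Pi\<^sub>E I (\<lambda>i. (\<lambda>y. a i + s * y) -` B i)"
      by (auto simp: space_PiM PiE_iff)
    also have "emeasure (lebP I) \<dots> = (\<Prod>i\<in>I. emeasure lborel ((\<lambda>y. a i + s * y) -` B i))"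
      using m1 I by (intro emeasure_PiM) auto
    also have "\<dots> = (\<Prod>i\<in>I. emeasure lborel (B i))"
      using B s by (intro prod.cong refl lborel_reflect_shift) auto
    finally show "emeasure (distr (lebP I) (lebP I) (\<lambda>t. \<lambda>i\<in>I. a i + s * t i)) (Pi\<^sub>E I B)
        = (\<Prod>i\<in>I. emeasure lborel (B i))" .
  qed (use I in auto)
qed

lemma nn_integral_lebP_reflect_shift:
  fixes s :: real
  assumes I: "finite I" and s: "s = 1 \<or> s = - 1" and f: "f \<in> borel_measurable (lebP I)"
  shows "(\<integral>\<^sup>+ t. f (\<lambda>i\<in>I. a i + s * t i) \<partial>lebP I) = (\<integral>\<^sup>+ t. f t \<partial>lebP I)"
proof -
  have meas: "(\<lambda>t. \<lambda>i\<in>I. a i + s * t i) \<in> measurable (lebP I) (lebP I)"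
    by measurable
  have "(\<integral>\<^sup>+ t. f t \<partial>lebP I)
      = (\<integral>\<^sup>+ t. f t \<partial>distr (lebP I) (lebP I) (\<lambda>t. \<lambda>i\<in>I. a i + s * t i))"
    by (simp add: distr_lebP_reflect_shift[OF I s])
  also have "\<dots> = (\<integral>\<^sup>+ t. f (\<lambda>i\<in>I. a i + s * t i) \<partial>lebP I)"
    using f by (intro nn_integral_distr meas) auto
  finally show ?thesis by simp
qed

text \<open>Uniqueness of Haar measure: the preimage measure under a surjective additive map is
  translation invariant, so applying Fubini to \<open>1\<^sub>X (x + L t) 1\<^sub>Q (L t)\<close> identifies it up to
  the factor that it gives to the unit cube \<open>Q\<close>.\<close>

lemma emeasure_lebP_additive_preimage:
  assumes I: "finite I" and L[measurable]: "L \<in> measurable (lebP I) (lebP I)"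
    and add: "\<And>s t. s \<in> space (lebP I) \<Longrightarrow> t \<in> space (lebP I) \<Longrightarrow>
                L (\<lambda>i\<in>I. s i + t i) = (\<lambda>i\<in>I. L s i + L t i)"
    and surj: "\<And>x. x \<in> space (lebP I) \<Longrightarrow> \<exists>s\<in>space (lebP I). L s = x"
    and X[measurable]: "X \<in> sets (lebP I)"
  shows "emeasure (lebP I) (L -` X \<inter> space (lebP I))
    = emeasure (lebP I) (L -` (\<Pi>\<^sub>E i\<in>I. {0..1}) \<inter> space (lebP I)) * emeasure (lebP I) X"
proof -
  let ?M = "lebP I"
  interpret product_sigma_finite "\<lambda>_::nat. lborel :: real measure" by standard
  interpret sigma_finite_measure ?M using I by (rule sigma_finite)
  interpret P: pair_sigma_finite ?M ?M by standard
  define Q :: "(nat \<Rightarrow> real) set" where "Q = (\<Pi>\<^sub>E i\<in>I. {0..1})"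
  have Q[measurable]: "Q \<in> sets ?M"
    unfolding Q_def using I by (intro sets_PiM_I_finite) auto
  have Q1: "emeasure ?M Q = 1"
    unfolding Q_def using I by (subst emeasure_PiM) auto
  have Lsp: "L t \<in> space ?M" if "t \<in> space ?M" for t
    using measurable_space[OF L that] .
  define f g :: "(nat \<Rightarrow> real) \<Rightarrow> ennreal" where "f = indicator X" and "g = indicator Q"
  have f[measurable]: "f \<in> borel_measurable ?M" and g[measurable]: "g \<in> borel_measurable ?M"
    unfolding f_def g_def by auto
  have plus[measurable]: "(\<lambda>(x, t). \<lambda>i\<in>I. x i + t i) \<in> measurable (?M \<Otimes>\<^sub>M ?M) ?M"
    by measurable
  have minus[measurable]: "(\<lambda>(x, t). \<lambda>i\<in>I. t i - x i) \<in> measurable (?M \<Otimes>\<^sub>M ?M) ?M"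
    by measurable
  have pre: "(\<integral>\<^sup>+ t. indicator Y (L t) \<partial>?M) = emeasure ?M (L -` Y \<inter> space ?M)"
    if [measurable]: "Y \<in> sets ?M" for Y
  proof -
    have "(\<integral>\<^sup>+ t. indicator Y (L t) \<partial>?M) = (\<integral>\<^sup>+ t. indicator (L -` Y \<inter> space ?M) t \<partial>?M)"
      by (intro nn_integral_cong) (auto simp: indicator_def)
    also have "\<dots> = emeasure ?M (L -` Y \<inter> space ?M)"
      by (intro nn_integral_indicator) measurable
    finally show ?thesis .
  qed
  have "emeasure ?M (L -` Q \<inter> space ?M) * emeasure ?M X
      = (\<integral>\<^sup>+ t. g (L t) * (\<integral>\<^sup>+ x. f x \<partial>?M) \<partial>?M)"
    using pre[of Q] by (subst nn_integral_multc) (simp_all add: f_def g_def)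
  \<comment> \<open>For fixed \<open>t\<close>, the integral of \<open>f\<close> is invariant under
    the shift by \<open>L t\<close>.\<close>
  also have "\<dots> = (\<integral>\<^sup>+ t. (\<integral>\<^sup>+ x. f (\<lambda>i\<in>I. x i + L t i) * g (L t) \<partial>?M) \<partial>?M)"
  proof (rule nn_integral_cong)
    fix t assume t: "t \<in> space ?M"
    have 0: "(\<lambda>x. \<lambda>i\<in>I. x i + L t i) \<in> measurable ?M ?M"
      by measurable
    have 1: "(\<lambda>x. f (\<lambda>i\<in>I. x i + L t i)) \<in> borel_measurable ?M"
      using measurable_compose[OF 0 f] .
    show "g (L t) * (\<integral>\<^sup>+ x. f x \<partial>?M) = (\<integral>\<^sup>+ x. f (\<lambda>i\<in>I. x i + L t i) * g (L t) \<partial>?M)"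
      using nn_integral_lebP_reflect_shift[OF I, of 1 f "L t"] 1
      by (subst nn_integral_multc) (simp_all add: add.commute mult.commute)
  qed
  also have "\<dots> = (\<integral>\<^sup>+ x. (\<integral>\<^sup>+ t. f (\<lambda>i\<in>I. x i + L t i) * g (L t) \<partial>?M) \<partial>?M)"
  proof -
    have "(\<lambda>p. f (case p of (x, t) \<Rightarrow> \<lambda>i\<in>I. x i + L t i) * g (L (snd p)))
        \<in> borel_measurable (?M \<Otimes>\<^sub>M ?M)"
    proof -
      have "(\<lambda>p. (fst p, L (snd p))) \<in> measurable (?M \<Otimes>\<^sub>M ?M) (?M \<Otimes>\<^sub>M ?M)"
        by measurable
      from measurable_compose[OF measurable_compose[OF this plus] f]
      show ?thesis by (auto simp: case_prod_beta)
    qed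
    then show ?thesis
      using P.Fubini'[of "\<lambda>x t. f (\<lambda>i\<in>I. x i + L t i) * g (L t)"]
      by (simp add: case_prod_beta)
  qed
  \<comment> \<open>Since \<open>x = L s\<close> for some \<open>s\<close>, substituting
    \<open>t - s\<close> for \<open>t\<close> turns \<open>x + L t\<close> into \<open>L t\<close>
    and \<open>L t\<close> into \<open>L t - x\<close>.\<close>
  also have "\<dots> = (\<integral>\<^sup>+ x. (\<integral>\<^sup>+ t. f (L t) * g (\<lambda>i\<in>I. L t i - x i) \<partial>?M) \<partial>?M)"
  proof (rule nn_integral_cong)
    fix x assume x: "x \<in> space ?M"
    then obtain s where s: "s \<in> space ?M" "L s = x"
      using surj by blast
    define h where "h t = f (L t) * g (\<lambda>i\<in>I. L t i - x i)" for t
    have 0: "(\<lambda>t. \<lambda>i\<in>I. L t i - x i) \<in> measurable ?M ?M"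
    proof -
      have "(\<lambda>t. (x, L t)) \<in> measurable ?M (?M \<Otimes>\<^sub>M ?M)"
        using x by measurable
      from measurable_compose[OF this minus] show ?thesis by simp
    qed
    have h[measurable]: "h \<in> borel_measurable ?M"
      unfolding h_def using measurable_compose[OF 0 g] by measurable
    have hs: "h (\<lambda>i\<in>I. s i + 1 * t i) = f (\<lambda>i\<in>I. x i + L t i) * g (L t)" if t: "t \<in> space ?M" for t
    proof -
      have "(\<lambda>i\<in>I. (\<lambda>i\<in>I. x i + L t i) i - x i) = L t"
        using Lsp[OF t] by (auto simp: space_PiM PiE_iff extensional_def)
      then show ?thesis
        unfolding h_def using add[OF s(1) t] s(2) by simp
    qed
    show "(\<integral>\<^sup>+ t. f (\<lambda>i\<in>I. x i + L t i) * g (L t) \<partial>?M)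
        = (\<integral>\<^sup>+ t. f (L t) * g (\<lambda>i\<in>I. L t i - x i) \<partial>?M)"
      using nn_integral_lebP_reflect_shift[OF I, of 1 h s] hs
      by (simp add: h_def[symmetric] cong: nn_integral_cong)
  qed
  also have "\<dots> = (\<integral>\<^sup>+ t. (\<integral>\<^sup>+ x. f (L t) * g (\<lambda>i\<in>I. L t i - x i) \<partial>?M) \<partial>?M)"
  proof -
    have "(\<lambda>p. (fst p, L (snd p))) \<in> measurable (?M \<Otimes>\<^sub>M ?M) (?M \<Otimes>\<^sub>M ?M)"
      by measurable
    from measurable_compose[OF measurable_compose[OF this minus] g]
    have "(\<lambda>p. f (L (snd p)) * g (\<lambda>i\<in>I. L (snd p) i - fst p i)) \<in> borel_measurable (?M \<Otimes>\<^sub>M ?M)"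
      by (auto simp: case_prod_beta)
    then show ?thesis
      using P.Fubini'[of "\<lambda>x t. f (L t) * g (\<lambda>i\<in>I. L t i - x i)"]
      by (simp add: case_prod_beta)
  qed
  also have "\<dots> = (\<integral>\<^sup>+ t. f (L t) * 1 \<partial>?M)"
  proof (rule nn_integral_cong)
    fix t assume t: "t \<in> space ?M"
    have 0: "(\<lambda>x. \<lambda>i\<in>I. L t i - x i) \<in> measurable ?M ?M"
      by measurable
    have 1: "(\<lambda>x. g (\<lambda>i\<in>I. L t i - x i)) \<in> borel_measurable ?M"
      using measurable_compose[OF 0 g] .
    \<comment> \<open>As a function of \<open>x\<close> the integrand is the indicator of a
      reflected translate of the unit cube.\<close>
    have "(\<integral>\<^sup>+ x. g (\<lambda>i\<in>I. L t i - x i) \<partial>?M) = 1"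
      using nn_integral_lebP_reflect_shift[OF I, of "-1" g "L t"] Q1 by (simp add: g_def)
    then show "(\<integral>\<^sup>+ x. f (L t) * g (\<lambda>i\<in>I. L t i - x i) \<partial>?M) = f (L t) * 1"
      using 1 by (subst nn_integral_cmult) auto
  qed
  also have "\<dots> = emeasure ?M (L -` X \<inter> space ?M)"
    using pre[of X] by (simp add: f_def)
  finally show ?thesis by (simp add: Q_def)
qed

section \<open>Volumes of bodies with given mean width over the sign vectors\<close>

text \<open>A sign vector is encoded by the set of its positive coordinates, so sums over
  \<open>Pow I\<close> are, up to the factor \<open>2 ^ card I\<close>, expectations over random
  signs.\<close>

definition sgv :: "nat set \<Rightarrow> nat \<Rightarrow> real" where
  "sgv S i = (if i \<in> S then 1 else - 1)"

definition flip :: "nat \<Rightarrow> nat set \<Rightarrow> nat set" where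
  "flip j S = (if j \<in> S then S - {j} else insert j S)"

lemma flip_flip [simp]: "flip j (flip j S) = S"
  by (auto simp: flip_def)

lemma flip_commute: "flip j (flip k S) = flip k (flip j S)"
  by (auto simp: flip_def)

lemma flip_subset: "j \<in> I \<Longrightarrow> S \<subseteq> I \<Longrightarrow> flip j S \<subseteq> I"
  by (auto simp: flip_def)

lemma sgv_flip: "sgv (flip j S) i = (if i = j then - sgv S i else sgv S i)"
  unfolding sgv_def flip_def by (cases "j \<in> S"; cases "i = j") simp_all

text \<open>\<open>H\<close> stands for bounds on a support function at the sign vectors only. A
  constant \<open>H\<close> gives a cross-polytope.\<close>

definition sign_polytope :: "nat set \<Rightarrow> (nat set \<Rightarrow> real) \<Rightarrow> (nat \<Rightarrow> real) set" where
  "sign_polytope I H = {t \<in> space (lebP I). \<forall>S\<in>Pow I. (\<Sum>i\<in>I. sgv S i * t i) \<le> H S}"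

lemma sets_sign_polytope:
  assumes "finite I"
  shows "sign_polytope I H \<in> sets (lebP I)"
proof -
  have "{t \<in> space (lebP I). (\<Sum>i\<in>I. sgv S i * t i) \<le> H S} \<in> sets (lebP I)" for S
    by measurable
  then show ?thesis
    unfolding sign_polytope_def using assms by (intro sets.sets_Collect_finite_All) auto
qed

section \<open>Steiner symmetrization in coordinate directions\<close>

text \<open>A compact convex set on the line is a segment, and its half-differences fill the centred
  segment of the same length.\<close>

lemma emeasure_interval_le_half_difference:
  fixes Y Z :: "real set"
  assumes Y: "convex Y" "compact Y" and Z: "Z \<in> sets borel"
    and diff: "\<And>a b. a \<in> Y \<Longrightarrow> b \<in> Y \<Longrightarrow> (a - b) / 2 \<in> Z"
  shows "emeasure lborel Y \<le> emeasure lborel Z"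
proof -
  have "connected Y" using Y(1) by (rule convex_connected)
  then obtain a b where ab: "Y = {a..b}"
    using connected_compact_interval_1[of Y] Y(2) by auto
  show ?thesis
  proof (cases "a \<le> b")
    case True
    have "{- (b - a) / 2..(b - a) / 2} \<subseteq> Z"
    proof
      fix r assume r: "r \<in> {- (b - a) / 2..(b - a) / 2}"
      show "r \<in> Z"
      proof (cases "r \<ge> 0")
        case True
        then have "a + 2 * r \<in> Y" "a \<in> Y" using r ab \<open>a \<le> b\<close> by auto
        from diff[OF this] show ?thesis by simp
      next
        case False
        then have "a \<in> Y" "a - 2 * r \<in> Y" using r ab \<open>a \<le> b\<close> by auto
        from diff[OF this] show ?thesis by simp
      qed
    qed
    then have "emeasure lborel {- (b - a) / 2..(b - a) / 2} \<le> emeasure lborel Z"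
      using Z by (intro emeasure_mono) auto
    moreover have "emeasure lborel {- (b - a) / 2..(b - a) / 2} = emeasure lborel Y"
      using True ab by (auto simp: field_simps)
    ultimately show ?thesis by simp
  qed (simp add: ab)
qed

text \<open>Steiner symmetrization in the direction of the \<open>j\<close>-th coordinate: half the difference of two
  points of a section of the left polytope lies in the same section of the right one.\<close>

lemma emeasure_sign_polytope_flip:
  assumes I: "finite I" and j: "j \<in> I"
  shows "emeasure (lebP I) (sign_polytope I H)
    \<le> emeasure (lebP I) (sign_polytope I (\<lambda>S. (H S + H (flip j S)) / 2))"
proof -
  interpret product_sigma_finite "\<lambda>_::nat. lborel :: real measure" by standard
  define J where "J = I - {j}"
  have J: "finite J" "j \<notin> J" "I = insert j J" using I j by (auto simp: J_def)
  have fubini: "emeasure (lebP I) (sign_polytope I G)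
      = (\<integral>\<^sup>+ x. emeasure lborel {y. x(j := y) \<in> sign_polytope I G} \<partial>lebP J)" for G
  proof -
    have "emeasure (lebP I) (sign_polytope I G)
        = (\<integral>\<^sup>+ t. indicator (sign_polytope I G) t \<partial>lebP (insert j J))"
      using nn_integral_indicator[OF sets_sign_polytope[OF I, of G]] J(3) by simp
    also have "\<dots> = (\<integral>\<^sup>+ x. (\<integral>\<^sup>+ y. indicator (sign_polytope I G) (x(j := y)) \<partial>lborel) \<partial>lebP J)"
      using J(1,2) sets_sign_polytope[OF I, of G] J(3)
      by (intro product_nn_integral_insert) auto
    also have "\<dots> = (\<integral>\<^sup>+ x. emeasure lborel {y. x(j := y) \<in> sign_polytope I G} \<partial>lebP J)"
    proof (rule nn_integral_cong)
      fix x assume x: "x \<in> space (lebP J)"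
      have "(\<lambda>y. x(j := y)) \<in> measurable lborel (lebP (insert j J))"
        using x J(2) by measurable
      then have "(\<lambda>y. x(j := y)) -` sign_polytope I G \<inter> space lborel \<in> sets lborel"
        using sets_sign_polytope[OF I, of G] J(3) by (intro measurable_sets) auto
      then have m: "{y. x(j := y) \<in> sign_polytope I G} \<in> sets lborel"
        by (simp add: vimage_def)
      have "(\<integral>\<^sup>+ y. indicator (sign_polytope I G) (x(j := y)) \<partial>lborel)
          = (\<integral>\<^sup>+ y. indicator {y. x(j := y) \<in> sign_polytope I G} y \<partial>lborel)"
        by (intro nn_integral_cong) (auto simp: indicator_def)
      then show "(\<integral>\<^sup>+ y. indicator (sign_polytope I G) (x(j := y)) \<partial>lborel)
          = emeasure lborel {y. x(j := y) \<in> sign_polytope I G}"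
        using m by simp
    qed
    finally show ?thesis .
  qed
  show ?thesis unfolding fubini
  proof (rule nn_integral_mono)
    fix x assume x: "x \<in> space (lebP J)"
    \<comment> \<open>The contribution of the coordinates other than \<open>j\<close>. It is the
      same for \<open>S\<close> and \<open>flip j S\<close>, so both signs of \<open>y\<close> meet
      the same constant.\<close>
    define c where "c S = (\<Sum>i\<in>J. sgv S i * x i)" for S
    have sect: "{y. x(j := y) \<in> sign_polytope I G} = {y. \<forall>S\<in>Pow I. sgv S j * y \<le> G S - c S}" for G
    proof -
      have "x(j := y) \<in> space (lebP I)" for y
        using x J by (auto simp: space_PiM PiE_iff extensional_def)
      moreover have "(\<Sum>i\<in>I. sgv S i * (x(j := y)) i) = sgv S j * y + c S" for S y
        using J by (auto simp: c_def intro!: sum.cong)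
      ultimately show ?thesis
        unfolding sign_polytope_def by (simp add: le_diff_eq)
    qed
    have cflip: "c (flip j S) = c S" for S
      using J(2) by (auto simp: c_def sgv_flip intro!: sum.cong)
    have closed: "closed {y. \<forall>S\<in>Pow I. sgv S j * y \<le> G S - c S}" for G
    proof -
      have "closed (\<Inter>S\<in>Pow I. {y. sgv S j * y \<le> G S - c S})"
        by (intro closed_INT ballI closed_Collect_le continuous_on_mult_left continuous_on_id continuous_on_const)
      also have "(\<Inter>S\<in>Pow I. {y. sgv S j * y \<le> G S - c S}) = {y. \<forall>S\<in>Pow I. sgv S j * y \<le> G S - c S}"
        by auto
      finally show ?thesis .
    qed
    let ?Y = "{y. \<forall>S\<in>Pow I. sgv S j * y \<le> H S - c S}"
    let ?H = "\<lambda>S. (H S + H (flip j S)) / 2"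
    show "emeasure lborel {y. x(j := y) \<in> sign_polytope I H}
        \<le> emeasure lborel {y. x(j := y) \<in> sign_polytope I ?H}"
      unfolding sect
    proof (rule emeasure_interval_le_half_difference)
      have "?Y = (\<Inter>S\<in>Pow I. {y. sgv S j \<bullet> y \<le> H S - c S})"
        by (auto simp: inner_real_def)
      then show "convex ?Y"
        using convex_INT[of "Pow I" "\<lambda>S. {y. sgv S j \<bullet> y \<le> H S - c S}"] convex_halfspace_le by metis
      \<comment> \<open>The \<open>j\<close>-th sign is negative for \<open>{}\<close> and positive
        for \<open>I\<close>, so these two constraints bound \<open>y\<close> on both sides.\<close>
      have "?Y \<subseteq> {- (H {} - c {})..H I - c I}"
      proof
        fix y assume "y \<in> ?Y"
        then have y: "\<forall>S\<in>Pow I. sgv S j * y \<le> H S - c S" by simp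
        from bspec[OF y, of "{}"] bspec[OF y, of I] j
        show "y \<in> {- (H {} - c {})..H I - c I}" by (simp add: sgv_def)
      qed
      then have "bounded ?Y"
        by (rule bounded_subset[OF bounded_closed_interval])
      with closed show "compact ?Y"
        by (simp add: compact_eq_bounded_closed)
      show "{y. \<forall>S\<in>Pow I. sgv S j * y \<le> ?H S - c S} \<in> sets borel"
        by (intro borel_closed closed)
    next
      fix a b assume a: "a \<in> ?Y" and b: "b \<in> ?Y"
      show "(a - b) / 2 \<in> {y. \<forall>S\<in>Pow I. sgv S j * y \<le> ?H S - c S}"
      proof safe
        fix S assume S: "S \<subseteq> I"
        have "sgv S j * a \<le> H S - c S" using a S by auto
        \<comment> \<open>The constraint at the flipped sign vector bounds \<open>- b\<close>;
          averaged with the one for \<open>a\<close> it gives the symmetrized bound.\<close>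
        moreover have "- sgv S j * b \<le> H (flip j S) - c S"
        proof -
          have "\<forall>S\<in>Pow I. sgv S j * b \<le> H S - c S" using b by simp
          from bspec[OF this, of "flip j S"] flip_subset[OF j S]
          show ?thesis by (simp add: sgv_flip cflip)
        qed
        ultimately show "sgv S j * ((a - b) / 2) \<le> ?H S - c S"
          by (simp add: field_simps)
      qed
    qed
  qed
qed

lemma sum_Pow_flip:
  assumes "j \<in> I"
  shows "(\<Sum>S\<in>Pow I. H (flip j S)) = (\<Sum>S\<in>Pow I. H S)"
proof (rule sum.reindex_bij_witness[where i = "flip j" and j = "flip j"])
  show "flip j S \<in> Pow I" if "S \<in> Pow I" for S
    using flip_subset[OF assms] that by simp
  then show "flip j S \<in> Pow I" if "S \<in> Pow I" for S
    using that .
qed simp_all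

text \<open>The coordinates in \<open>A\<close> are symmetrized one after another. Flips commute, so
  each averaging keeps the invariances already gained, and it only permutes and averages the values
  of \<open>H\<close>, so their sum stays.\<close>

lemma emeasure_sign_polytope_symmetrize:
  fixes H :: "nat set \<Rightarrow> real"
  assumes I: "finite I" and A: "A \<subseteq> I"
  shows "\<exists>H'. emeasure (lebP I) (sign_polytope I H) \<le> emeasure (lebP I) (sign_polytope I H')
     \<and> (\<Sum>S\<in>Pow I. H' S) = (\<Sum>S\<in>Pow I. H S) \<and> (\<forall>j\<in>A. \<forall>S. H' (flip j S) = H' S)"
  using finite_subset[OF A I] A
proof (induction A rule: finite_induct)
  case empty
  then show ?case by auto
next
  case (insert j A)
  then obtain H' where H': "emeasure (lebP I) (sign_polytope I H) \<le> emeasure (lebP I) (sign_polytope I H')"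
     "(\<Sum>S\<in>Pow I. H' S) = (\<Sum>S\<in>Pow I. H S)" "\<And>j S. j \<in> A \<Longrightarrow> H' (flip j S) = H' S"
    by auto
  have j: "j \<in> I" using insert by auto
  define H'' where "H'' S = (H' S + H' (flip j S)) / 2" for S
  have "emeasure (lebP I) (sign_polytope I H) \<le> emeasure (lebP I) (sign_polytope I H'')"
    unfolding H''_def using H'(1) emeasure_sign_polytope_flip[OF I j] by (rule order_trans)
  moreover have "(\<Sum>S\<in>Pow I. H'' S) = (\<Sum>S\<in>Pow I. H S)"
    unfolding H''_def using H'(2) sum_Pow_flip[OF j, of H']
    by (simp add: sum_divide_distrib[symmetric] sum.distrib)
  moreover have "H'' (flip k S) = H'' S" if "k \<in> insert j A" for k S
    using that H'(3)[of k S] H'(3)[of k "flip j S"]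
    by (auto simp: H''_def flip_commute[of j k] add.commute)
  ultimately show ?case by (intro exI[of _ H'']) simp
qed

section \<open>From the cross-polytope to polytopes of given mean width\<close>

lemma nn_integral_exp_minus_abs:
  fixes a :: real
  assumes a: "a > 0"
  shows "(\<integral>\<^sup>+ y. ennreal (exp (- a * \<bar>y\<bar>)) \<partial>lborel) \<le> ennreal (2 / a)"
proof -
  define f where "f y = ennreal (exp (- a * y)) * indicator {0..} y" for y :: real
  have f[measurable]: "f \<in> borel_measurable borel"
    unfolding f_def by measurable
  have half: "(\<integral>\<^sup>+ y. f y \<partial>lborel) = ennreal (1 / a)"
  proof -
    have "(\<integral>\<^sup>+ y. f y \<partial>lborel) = ennreal (0 - (- exp (- a * 0) / a))"
      unfolding f_def
    proof (rule nn_integral_FTC_atLeast)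
      show "((\<lambda>y. - exp (- a * y) / a) has_real_derivative exp (- a * y)) (at y)" for y
        using a by (auto intro!: derivative_eq_intros)
      have "filterlim (\<lambda>y. a * y) at_top at_top"
        using a filterlim_tendsto_pos_mult_at_top[OF tendsto_const _ filterlim_ident] by auto
      then have "((\<lambda>y. exp (- (a * y))) \<longlongrightarrow> 0) at_top"
        by (intro filterlim_compose[OF exp_at_bot] filterlim_compose[OF filterlim_uminus_at_bot_at_top])
      from tendsto_divide[OF tendsto_minus[OF this] tendsto_const[of a]]
      show "((\<lambda>y. - exp (- a * y) / a) \<longlongrightarrow> 0) at_top" using a by simp
    qed auto
    then show ?thesis by simp
  qed
  \<comment> \<open>The point \<open>y = 0\<close> is counted on both half-lines, hence an
    inequality.\<close>
  have "(\<integral>\<^sup>+ y. ennreal (exp (- a * \<bar>y\<bar>)) \<partial>lborel) \<le> (\<integral>\<^sup>+ y. f y + f (0 + (- 1) * y) \<partial>lborel)"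
    by (rule nn_integral_mono) (auto simp: f_def indicator_def)
  also have "\<dots> = (\<integral>\<^sup>+ y. f y \<partial>lborel) + (\<integral>\<^sup>+ y. f (0 + (- 1) * y) \<partial>lborel)"
    by (rule nn_integral_add) measurable
  also have "(\<integral>\<^sup>+ y. f (0 + (- 1) * y) \<partial>lborel) = (\<integral>\<^sup>+ y. f y \<partial>lborel)"
    using nn_integral_real_affine[OF f, of "-1" 0] by simp
  also have "(\<integral>\<^sup>+ y. f y \<partial>lborel) + (\<integral>\<^sup>+ y. f y \<partial>lborel) = ennreal (2 / a)"
    unfolding half using a by (simp flip: ennreal_plus)
  finally show ?thesis .
qed

text \<open>Exponential Markov bound: the indicator is at most \<open>exp (a * w)\<close> times the
  product of the \<open>exp (- a * \<bar>t i\<bar>)\<close>, whose integral factorizes.\<close>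

lemma emeasure_crosspolytope_le:
  fixes w :: real
  assumes I: "finite I" "I \<noteq> {}" and w: "w > 0"
  shows "emeasure (lebP I) {t \<in> space (lebP I). (\<Sum>i\<in>I. \<bar>t i\<bar>) \<le> w}
    \<le> ennreal ((2 * exp 1 * w / real (card I)) ^ card I)"
proof -
  interpret product_sigma_finite "\<lambda>_::nat. lborel :: real measure" by standard
  define m where "m = card I"
  have m: "m > 0" using I by (simp add: m_def card_gt_0_iff)
  \<comment> \<open>This \<open>a\<close> minimizes the resulting bound
    \<open>exp (a * w) * (2 / a) ^ m\<close>.\<close>
  define a where "a = real m / w"
  have a: "a > 0" using m w by (simp add: a_def)
  let ?X = "{t \<in> space (lebP I). (\<Sum>i\<in>I. \<bar>t i\<bar>) \<le> w}"
  have X: "?X \<in> sets (lebP I)" by measurable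
  have "emeasure (lebP I) ?X = (\<integral>\<^sup>+ t. indicator ?X t \<partial>lebP I)"
    by (rule nn_integral_indicator[OF X, symmetric])
  also have "\<dots> \<le> (\<integral>\<^sup>+ t. ennreal (exp 1 ^ m) * (\<Prod>i\<in>I. ennreal (exp (- a * \<bar>t i\<bar>))) \<partial>lebP I)"
  proof (rule nn_integral_mono)
    fix t assume t: "t \<in> space (lebP I)"
    show "indicator ?X t \<le> ennreal (exp 1 ^ m) * (\<Prod>i\<in>I. ennreal (exp (- a * \<bar>t i\<bar>)))"
    proof (cases "t \<in> ?X")
      case True
      then have "a * (\<Sum>i\<in>I. \<bar>t i\<bar>) \<le> a * w"
        using a by (intro mult_left_mono) auto
      also have "a * w = real m" using w by (simp add: a_def)
      finally have "1 \<le> exp (real m - a * (\<Sum>i\<in>I. \<bar>t i\<bar>))" by simp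
      also have "\<dots> = exp 1 ^ m * (\<Prod>i\<in>I. exp (- a * \<bar>t i\<bar>))"
        using I by (simp add: exp_diff exp_of_nat_mult[symmetric] exp_sum sum_distrib_left
            exp_minus divide_inverse prod_inversef[symmetric] comp_def)
      finally show ?thesis
        by (simp add: prod_ennreal ennreal_mult[symmetric] prod_nonneg indicator_def)
    next
      case False
      then show ?thesis by (simp only: indicator_simps(2) zero_le not_False_eq_True)
    qed
  qed
  also have "\<dots> = ennreal (exp 1 ^ m) * (\<Prod>i\<in>I. \<integral>\<^sup>+ y. ennreal (exp (- a * \<bar>y\<bar>)) \<partial>lborel)"
  proof -
    have "(\<integral>\<^sup>+ t. (\<Prod>i\<in>I. ennreal (exp (- a * \<bar>t i\<bar>))) \<partial>lebP I)
        = (\<Prod>i\<in>I. \<integral>\<^sup>+ y. ennreal (exp (- a * \<bar>y\<bar>)) \<partial>lborel)"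
      using I by (intro product_nn_integral_prod) auto
    moreover have "(\<lambda>t. \<Prod>i\<in>I. ennreal (exp (- a * \<bar>t i\<bar>))) \<in> borel_measurable (lebP I)"
      by measurable
    ultimately show ?thesis
      by (simp add: nn_integral_cmult)
  qed
  also have "\<dots> \<le> ennreal (exp 1 ^ m) * (\<Prod>i\<in>I. ennreal (2 / a))"
    using nn_integral_exp_minus_abs[OF a] by (simp only: prod_constant, intro mult_left_mono power_mono) simp_all
  also have "\<dots> = ennreal (exp 1 ^ m * (2 / a) ^ m)"
    using a by (simp add: m_def ennreal_power ennreal_mult)
  also have "exp 1 ^ m * (2 / a) ^ m = (2 * exp 1 * w / real m) ^ m"
    unfolding power_mult_distrib[symmetric] a_def by (simp add: ac_simps)
  finally show ?thesis by (simp add: m_def)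
qed

text \<open>Symmetrizing in all coordinates makes the bounds constant without changing their mean,
  which is at most \<open>w\<close>; the polytope then lies in the cross-polytope of radius
  \<open>w\<close>.\<close>

lemma emeasure_sign_polytope_le:
  assumes I: "finite I" "I \<noteq> {}" and w: "w > 0"
    and H: "(\<Sum>S\<in>Pow I. H S) \<le> 2 ^ card I * w"
  shows "emeasure (lebP I) (sign_polytope I H) \<le> ennreal ((2 * exp 1 * w / real (card I)) ^ card I)"
proof -
  obtain G where G: "emeasure (lebP I) (sign_polytope I H) \<le> emeasure (lebP I) (sign_polytope I G)"
     "(\<Sum>S\<in>Pow I. G S) = (\<Sum>S\<in>Pow I. H S)" "\<And>j S. j \<in> I \<Longrightarrow> G (flip j S) = G S"
    using emeasure_sign_polytope_symmetrize[OF I(1) subset_refl, of H] by blast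
  have const: "G S = G {}" if "S \<subseteq> I" for S
    using finite_subset[OF that I(1)] that
  proof (induction S rule: finite_induct)
    case (insert j S)
    then have "G (flip j S) = G {}" using G(3)[of j S] by simp
    then show ?case using insert by (simp add: flip_def)
  qed simp
  have "(\<Sum>S\<in>Pow I. G S) = (\<Sum>S\<in>Pow I. G {})"
    by (rule sum.cong) (auto intro: const)
  then have Gw: "G {} \<le> w"
    using G(2) H I(1) by (simp add: card_Pow)
  have "sign_polytope I G \<subseteq> {t \<in> space (lebP I). (\<Sum>i\<in>I. \<bar>t i\<bar>) \<le> w}"
  proof safe
    fix t assume t: "t \<in> sign_polytope I G"
    then show "t \<in> space (lebP I)" by (simp add: sign_polytope_def)
    \<comment> \<open>The sign pattern of \<open>t\<close> selects the constraint whose left side is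
      the sum of the \<open>\<bar>t i\<bar>\<close>.\<close>
    define S where "S = {i\<in>I. t i \<ge> 0}"
    have "(\<Sum>i\<in>I. \<bar>t i\<bar>) = (\<Sum>i\<in>I. sgv S i * t i)"
      by (rule sum.cong) (auto simp: S_def sgv_def)
    also have "\<dots> \<le> G S"
      using t by (auto simp: sign_polytope_def S_def)
    also have "\<dots> \<le> w" using const[of S] Gw by (auto simp: S_def)
    finally show "(\<Sum>i\<in>I. \<bar>t i\<bar>) \<le> w" .
  qed
  then have "emeasure (lebP I) (sign_polytope I G)
      \<le> emeasure (lebP I) {t \<in> space (lebP I). (\<Sum>i\<in>I. \<bar>t i\<bar>) \<le> w}"
    by (rule emeasure_mono) measurable
  also have "\<dots> \<le> ennreal ((2 * exp 1 * w / real (card I)) ^ card I)"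
    by (rule emeasure_crosspolytope_le[OF I w])
  finally show ?thesis using G(1) by (rule order_trans[rotated])
qed

section \<open>Averages over the sign vectors\<close>

lemma sum_Pow_insert:
  assumes "finite I" "j \<notin> I"
  shows "(\<Sum>S\<in>Pow (insert j I). f S) = (\<Sum>S\<in>Pow I. f S + f (insert j S))"
proof -
  have "inj_on (insert j) (Pow I)"
    using assms(2) by (auto simp: inj_on_def)
  moreover have "Pow I \<inter> insert j ` Pow I = {}"
    using assms(2) by blast
  ultimately show ?thesis
    using assms(1) by (simp add: Pow_insert sum.union_disjoint sum.reindex sum.distrib)
qed

text \<open>Flipping the \<open>i\<close>-th sign cancels its terms in pairs. Hence translating a
  body does not change its mean width.\<close>

lemma sum_Pow_sgv_linear:
  assumes I: "finite I"
  shows "(\<Sum>S\<in>Pow I. \<Sum>i\<in>I. sgv S i * c i) = 0"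
proof -
  have "(\<Sum>S\<in>Pow I. sgv S i) = 0" if "i \<in> I" for i
    using sum_Pow_flip[OF that, of "\<lambda>S. sgv S i"] by (simp add: sgv_flip sum_negf)
  then show ?thesis
    by (subst sum.swap) (simp add: sum_distrib_right[symmetric])
qed

text \<open>Orthogonality of random signs; in the induction the two signs of the new coordinate
  combine by the parallelogram identity.\<close>

lemma sum_Pow_sgv_square:
  assumes I: "finite I"
  shows "(\<Sum>S\<in>Pow I. (\<Sum>i\<in>I. sgv S i * c i)\<^sup>2) = 2 ^ card I * (\<Sum>i\<in>I. (c i)\<^sup>2)"
  using I
proof (induction I rule: finite_induct)
  case (insert j I)
  have 1: "(\<Sum>i\<in>insert j I. sgv S i * c i) = (\<Sum>i\<in>I. sgv S i * c i) - c j" if "S \<in> Pow I" for S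
  proof -
    have "sgv S j = - 1" using insert.hyps(2) that by (auto simp: sgv_def)
    then show ?thesis using insert.hyps by simp
  qed
  have 2: "(\<Sum>i\<in>insert j I. sgv (insert j S) i * c i) = (\<Sum>i\<in>I. sgv S i * c i) + c j" if "S \<in> Pow I" for S
  proof -
    have "(\<Sum>i\<in>I. sgv (insert j S) i * c i) = (\<Sum>i\<in>I. sgv S i * c i)"
      using insert.hyps by (intro sum.cong) (auto simp: sgv_def)
    then show ?thesis using insert.hyps by (simp add: sgv_def)
  qed
  have "(\<Sum>S\<in>Pow (insert j I). (\<Sum>i\<in>insert j I. sgv S i * c i)\<^sup>2)
      = (\<Sum>S\<in>Pow I. (\<Sum>i\<in>insert j I. sgv S i * c i)\<^sup>2 + (\<Sum>i\<in>insert j I. sgv (insert j S) i * c i)\<^sup>2)"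
    using insert.hyps by (intro sum_Pow_insert) auto
  also have "\<dots> = (\<Sum>S\<in>Pow I. 2 * (\<Sum>i\<in>I. sgv S i * c i)\<^sup>2 + 2 * (c j)\<^sup>2)"
    by (rule sum.cong[OF refl]) (simp only: 1 2, simp add: power2_eq_square algebra_simps)
  also have "\<dots> = 2 * (2 ^ card I * (\<Sum>i\<in>I. (c i)\<^sup>2)) + 2 ^ card I * (2 * (c j)\<^sup>2)"
    using insert by (simp add: sum.distrib sum_distrib_left[symmetric] card_Pow)
  finally show ?case using insert by (simp add: algebra_simps)
qed simp

text \<open>The easy half of Khintchine's inequality, by Cauchy-Schwarz from the second moment. It
  bounds the mean width of a segment by its Euclidean length.\<close>

lemma sum_Pow_abs_sgv_le:
  assumes I: "finite I" and c: "(\<Sum>i\<in>I. (c i)\<^sup>2) \<le> r"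
  shows "(\<Sum>S\<in>Pow I. \<bar>\<Sum>i\<in>I. sgv S i * c i\<bar>) \<le> 2 ^ card I * sqrt r"
proof -
  let ?f = "\<lambda>S. \<bar>\<Sum>i\<in>I. sgv S i * c i\<bar>"
  have "(\<Sum>S\<in>Pow I. ?f S)\<^sup>2 \<le> (\<Sum>S\<in>Pow I. (?f S)\<^sup>2) * (\<Sum>S\<in>Pow I. 1\<^sup>2)"
    using Cauchy_Schwarz_ineq_sum[of ?f "\<lambda>_. 1" "Pow I"] by simp
  also have "\<dots> = (2 ^ card I)\<^sup>2 * (\<Sum>i\<in>I. (c i)\<^sup>2)"
    using sum_Pow_sgv_square[OF I, of c] I by (simp add: card_Pow power2_eq_square)
  also have "\<dots> \<le> (2 ^ card I)\<^sup>2 * r"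
    using c by (intro mult_left_mono) auto
  finally have "(\<Sum>S\<in>Pow I. ?f S) \<le> sqrt ((2 ^ card I)\<^sup>2 * r)"
    by (rule real_le_rsqrt)
  then show ?thesis by (simp add: real_sqrt_mult)
qed

section \<open>Sections by a coordinate subspace\<close>

abbreviation unitv :: "nat \<Rightarrow> (nat \<Rightarrow>\<^sub>0 real)" where
  "unitv i \<equiv> Poly_Mapping.single i 1"

abbreviation lkp :: "(nat \<Rightarrow>\<^sub>0 real) \<Rightarrow> nat \<Rightarrow> real" where
  "lkp \<equiv> Poly_Mapping.lookup"

lemma lookup_unitv: "lkp (unitv i) k = (if k = i then 1 else 0)"
  by (simp add: lookup_single_not_eq)

lemma lookup_scaleR [simp]: "lkp (r *\<^sub>R x) i = r * lkp x i"
proof -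
  have "finite {i. r *\<^sub>R lkp x i \<noteq> 0}"
    by (rule finite_subset[OF _ finite_lookup[of x]]) auto
  then show ?thesis
    by (simp add: scaleR_poly_mapping_def Abs_poly_mapping_inverse)
qed

lemma linear_lookup: "linear (\<lambda>z. lkp z i)"
  by (intro linearI) (simp_all add: lookup_add)

lemma abs_lookup_le_norm: "\<bar>lkp z i\<bar> \<le> norm z"
proof (cases "i \<in> Poly_Mapping.keys z")
  case True
  then have "norm (lkp z i) \<le> (\<Sum>i\<in>Poly_Mapping.keys z. norm (lkp z i))"
    by (intro member_le_sum) auto
  then show ?thesis by (simp add: norm_poly_mapping_def dist_poly_mapping_def)
qed (simp add: in_keys_iff)

lemma Rn_iff: "z \<in> Rn n \<longleftrightarrow> (\<forall>i\<ge>n. lkp z i = 0)"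
  by (auto simp: Rn_def in_keys_iff subset_iff) (meson leI)

lemma subspace_Rn: "subspace (Rn n)"
  by (auto simp: subspace_def Rn_iff lookup_add)

lemma Rn_mono: "m \<le> n \<Longrightarrow> Rn m \<subseteq> Rn n"
  by (auto simp: Rn_def)

lemma unitv_Rn: "i < n \<Longrightarrow> unitv i \<in> Rn n"
  by (auto simp: Rn_iff lookup_single_not_eq)

lemma lookup_sum_unitv:
  "lkp (\<Sum>i<n. t i *\<^sub>R unitv i) k = (if k < n then t k else 0)"
proof -
  have "lkp (\<Sum>i<n. t i *\<^sub>R unitv i) k = (\<Sum>i<n. if i = k then t k else 0)"
    unfolding lookup_sum by (rule sum.cong) (auto simp: lookup_single_not_eq)
  then show ?thesis by simp
qed

lemma Rn_expansion: "z \<in> Rn n \<Longrightarrow> (\<Sum>i<n. lkp z i *\<^sub>R unitv i) = z"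
  by (rule poly_mapping_eqI) (simp add: lookup_sum_unitv Rn_iff)

lemma span_unitv: "span (unitv ` {..<n}) = Rn n"
proof
  show "span (unitv ` {..<n}) \<subseteq> Rn n"
    by (rule span_minimal) (auto simp: subspace_Rn unitv_Rn)
  show "Rn n \<subseteq> span (unitv ` {..<n})"
  proof
    fix z assume "z \<in> Rn n"
    then have "z = (\<Sum>i<n. lkp z i *\<^sub>R unitv i)" by (simp add: Rn_expansion)
    also have "\<dots> \<in> span (unitv ` {..<n})"
      by (intro span_sum span_scale span_base) auto
    finally show "z \<in> span (unitv ` {..<n})" .
  qed
qed

lemma inj_unitv: "inj unitv"
  by (rule injI) (metis lookup_single_eq lookup_single_not_eq zero_neq_one)

lemma independent_unitv: "independent (unitv ` {..<n})"
proof (rule independent_if_scalars_zero)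
  fix f x assume f: "(\<Sum>x\<in>unitv ` {..<n}. f x *\<^sub>R x) = 0" and x: "x \<in> unitv ` {..<n}"
  have "(\<Sum>x\<in>unitv ` {..<n}. f x *\<^sub>R x) = (\<Sum>i<n. f (unitv i) *\<^sub>R unitv i)"
    by (subst sum.reindex) (auto intro: inj_on_subset[OF inj_unitv])
  with f have "lkp (\<Sum>i<n. f (unitv i) *\<^sub>R unitv i) k = 0" for k by simp
  then have "(if k < n then f (unitv k) else 0) = 0" for k by (simp only: lookup_sum_unitv)
  with x show "f x = 0" by (metis imageE lessThan_iff)
qed simp

lemma dim_Rn: "dim (Rn n) = n"
proof -
  have "dim (Rn n) = card (unitv ` {..<n})"
    by (rule dim_eq_card[OF _ independent_unitv]) (metis span_unitv span_span)
  also have "\<dots> = n"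
    by (subst card_image) (auto intro: inj_on_subset[OF inj_unitv])
  finally show ?thesis .
qed

lemma dot_Rn: "x \<in> Rn n \<Longrightarrow> dot x y = (\<Sum>i<n. lkp x i * lkp y i)"
  unfolding dot_def by (rule sum.mono_neutral_left) (auto simp: Rn_def in_keys_iff)

lemma orthonormal_basis_unitv: "orthonormal_basis (Rn n) unitv"
  unfolding orthonormal_basis_def dim_Rn
proof (intro conjI allI impI span_unitv)
  fix i j assume ij: "i < n" "j < n"
  have "(\<Sum>k<n. lkp (unitv i) k * lkp (unitv j) k) = (\<Sum>k<n. if k = i then lkp (unitv j) i else 0)"
    by (rule sum.cong) (auto simp: lookup_single_not_eq)
  then show "dot (unitv i) (unitv j) = (if i = j then 1 else 0)"
    using ij by (auto simp: dot_Rn[OF unitv_Rn[OF ij(1)]] lookup_single_not_eq)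
qed

section \<open>Volumes in coordinates\<close>

text \<open>On the product over all of \<open>nat\<close> the map is continuous and Borel sets
  coincide with the product sigma-algebra, because the index set is countable. Extension by zero
  brings this back to the finite product.\<close>

lemma sets_lebP_closed_preimage:
  fixes b :: "nat \<Rightarrow> (nat \<Rightarrow>\<^sub>0 real)"
  assumes A: "closed A"
  shows "{t \<in> space (lebP {..<m}). (\<Sum>i<m. t i *\<^sub>R b i) + x \<in> A} \<in> sets (lebP {..<m})"
proof -
  define f where "f t = (\<Sum>i<m. t i *\<^sub>R b i) + x" for t :: "nat \<Rightarrow> real"
  have "continuous_on UNIV f"
    unfolding f_def by (intro continuous_intros continuous_on_product_coordinates)
  then have "closed (f -` A)"
    using A by (simp add: closed_vimage)
  then have S: "f -` A \<in> sets (Pi\<^sub>M UNIV (\<lambda>_::nat. borel :: real measure))"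
    by (subst sets_PiM_equal_borel) auto
  have "(\<lambda>t i. if i < m then t i else 0) \<in> measurable (lebP {..<m}) (Pi\<^sub>M UNIV (\<lambda>_::nat. borel :: real measure))"
  proof (rule measurable_abs_UNIV)
    fix i show "(\<lambda>t. if i < m then t i else 0) \<in> measurable (lebP {..<m}) (borel :: real measure)"
      by (cases "i < m") auto
  qed
  from measurable_sets[OF this S]
  have "(\<lambda>t i. if i < m then t i else 0) -` (f -` A) \<inter> space (lebP {..<m}) \<in> sets (lebP {..<m})" .
  also have "(\<lambda>t i. if i < m then t i else 0) -` (f -` A) \<inter> space (lebP {..<m})
      = {t \<in> space (lebP {..<m}). (\<Sum>i<m. t i *\<^sub>R b i) + x \<in> A}"
    by (auto simp: f_def)
  finally show ?thesis .
qed

lemma emeasure_lebP_box: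
  assumes "\<And>i. i < m \<Longrightarrow> u i \<le> v i"
  shows "emeasure (lebP {..<m}) (\<Pi>\<^sub>E i\<in>{..<m}. {u i..v i}) = ennreal (\<Prod>i<m. v i - u i)"
proof -
  interpret product_sigma_finite "\<lambda>_::nat. lborel :: real measure" by standard
  have "emeasure (lebP {..<m}) (\<Pi>\<^sub>E i\<in>{..<m}. {u i..v i}) = (\<Prod>i<m. ennreal (v i - u i))"
    using assms by (subst emeasure_PiM) (auto intro!: prod.cong)
  also have "\<dots> = ennreal (\<Prod>i<m. v i - u i)"
    using assms by (intro prod_ennreal) auto
  finally show ?thesis .
qed

text \<open>\<^const>\<open>vol\<close> uses an unspecified orthonormal basis; up to a factor that is the same for all
  sets, it is the volume in the coordinates of \<open>Rn m\<close>.\<close>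

lemma vol_Rn_coordinates:
  obtains c where "c \<ge> 0"
    and "\<And>x A X. X \<in> sets (lebP {..<m}) \<Longrightarrow> emeasure (lebP {..<m}) X < \<infinity> \<Longrightarrow>
      (\<And>t. t \<in> space (lebP {..<m}) \<Longrightarrow> (\<Sum>i<m. t i *\<^sub>R unitv i) + x \<in> A \<Longrightarrow> t \<in> X) \<Longrightarrow>
      vol (Rn m) x A \<le> c * measure (lebP {..<m}) X"
    and "\<And>A X. compact A \<Longrightarrow> X \<in> sets (lebP {..<m}) \<Longrightarrow>
      (\<And>t. t \<in> X \<Longrightarrow> (\<Sum>i<m. t i *\<^sub>R unitv i) \<in> A) \<Longrightarrow>
      c * measure (lebP {..<m}) X \<le> vol (Rn m) 0 (A \<inter> Rn m)"
proof -
  let ?M = "lebP {..<m}"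
  define b where "b = (SOME b. orthonormal_basis (Rn m) b)"
  have "orthonormal_basis (Rn m) b"
    unfolding b_def by (rule someI[where P = "orthonormal_basis (Rn m)", OF orthonormal_basis_unitv])
  then have dotb: "\<And>i j. i < m \<Longrightarrow> j < m \<Longrightarrow> dot (b i) (b j) = (if i = j then 1 else 0)"
    and spanb: "span (b ` {..<m}) = Rn m"
    by (simp_all add: orthonormal_basis_def dim_Rn)
  have bRn: "b i \<in> Rn m" if "i < m" for i
    using span_base[of "b i" "b ` {..<m}"] that spanb by auto
  define T where "T t = (\<Sum>i<m. t i *\<^sub>R b i)" for t
  \<comment> \<open>\<open>L\<close> changes coordinates from the chosen basis \<open>b\<close> to
    the standard one.\<close>
  define L where "L t = (\<lambda>i\<in>{..<m}. lkp (T t) i)" for t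
  have TRn: "T t \<in> Rn m" for t
    unfolding T_def by (intro subspace_sum[OF subspace_Rn] subspace_scale[OF subspace_Rn] bRn) auto
  have TL: "T t = (\<Sum>i<m. L t i *\<^sub>R unitv i)" for t
  proof -
    have "(\<Sum>i<m. L t i *\<^sub>R unitv i) = (\<Sum>i<m. lkp (T t) i *\<^sub>R unitv i)"
      by (rule sum.cong) (auto simp: L_def)
    then show ?thesis by (simp add: Rn_expansion[OF TRn])
  qed
  have vol_eq: "vol (Rn m) x A = measure ?M {t \<in> space ?M. T t + x \<in> A}" for x A
    unfolding vol_def T_def Let_def dim_Rn b_def ..
  have L[measurable]: "L \<in> measurable ?M ?M"
    unfolding L_def T_def lookup_sum lookup_scaleR by measurable
  have Lsp: "L t \<in> space ?M" for t
    by (simp add: L_def space_PiM)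
  have add: "L (\<lambda>i\<in>{..<m}. s i + t i) = (\<lambda>i\<in>{..<m}. L s i + L t i)" for s t
    by (auto simp: L_def T_def lookup_sum lookup_add scaleR_add_left sum.distrib algebra_simps
        intro!: restrict_ext)
  have surj: "\<exists>s\<in>space ?M. L s = x" if x: "x \<in> space ?M" for x
  proof -
    have "(\<Sum>i<m. x i *\<^sub>R unitv i) \<in> span (b ` {..<m})"
      unfolding spanb by (intro subspace_sum[OF subspace_Rn] subspace_scale[OF subspace_Rn] unitv_Rn) auto
    also have "span (b ` {..<m}) = range (\<lambda>u. \<Sum>v\<in>b ` {..<m}. u v *\<^sub>R v)"
      by (rule span_finite) simp
    finally obtain u where u: "(\<Sum>i<m. x i *\<^sub>R unitv i) = (\<Sum>v\<in>b ` {..<m}. u v *\<^sub>R v)" by auto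
    have injb: "inj_on b {..<m}"
    proof (rule inj_onI)
      fix i j assume ij: "i \<in> {..<m}" "j \<in> {..<m}" "b i = b j"
      have "(if i = j then 1 else 0 :: real) = dot (b i) (b j)" using ij(1,2) by (simp add: dotb)
      also have "\<dots> = dot (b i) (b i)" using ij(3) by simp
      also have "\<dots> = 1" using ij(1) by (simp add: dotb)
      finally show "i = j" by (simp split: if_splits)
    qed
    define s where "s = (\<lambda>i\<in>{..<m}. u (b i))"
    have "T s = (\<Sum>i<m. x i *\<^sub>R unitv i)"
      unfolding u by (simp add: T_def s_def sum.reindex[OF injb])
    then have "L s = x"
      using x by (auto simp: L_def lookup_sum_unitv space_PiM PiE_iff extensional_def)
    moreover have "s \<in> space ?M" by (simp add: s_def space_PiM)
    ultimately show ?thesis by blast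
  qed
  have pre: "emeasure ?M (L -` X \<inter> space ?M)
      = emeasure ?M (L -` (\<Pi>\<^sub>E i\<in>{..<m}. {0..1}) \<inter> space ?M) * emeasure ?M X"
    if "X \<in> sets ?M" for X
    by (rule emeasure_lebP_additive_preimage[OF _ L add surj that]) auto
  \<comment> \<open>By orthonormality \<open>t i\<close> is the inner product of \<open>T t\<close>
    with \<open>b i\<close>, whose entries are at most 1 in absolute value. So \<open>L\<close>
    pulls bounded sets back to bounded sets.\<close>
  have coord: "\<bar>t i\<bar> \<le> (\<Sum>k<m. \<bar>L t k\<bar>)" if i: "i < m" for t i
  proof -
    have bk: "\<bar>lkp (b i) k\<bar> \<le> 1" if "k < m" for k
    proof -
      have "(lkp (b i) k)\<^sup>2 \<le> (\<Sum>k<m. (lkp (b i) k)\<^sup>2)"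
        using that by (intro member_le_sum) auto
      also have "\<dots> = dot (b i) (b i)"
        by (simp add: dot_Rn[OF bRn[OF i]] power2_eq_square)
      also have "\<dots> = 1" using i by (simp add: dotb)
      finally show ?thesis by (simp add: abs_square_le_1)
    qed
    have "t i = (\<Sum>j<m. if j = i then t j else 0)" using i by simp
    also have "\<dots> = (\<Sum>j<m. t j * dot (b j) (b i))"
      by (rule sum.cong) (auto simp: dotb i)
    also have "\<dots> = (\<Sum>j<m. \<Sum>k<m. t j * (lkp (b j) k * lkp (b i) k))"
      by (rule sum.cong) (auto simp: dot_Rn[OF bRn] sum_distrib_left)
    also have "\<dots> = (\<Sum>k<m. L t k * lkp (b i) k)"
      by (subst sum.swap) (simp add: L_def T_def lookup_sum sum_distrib_right mult.assoc)
    finally have "\<bar>t i\<bar> \<le> (\<Sum>k<m. \<bar>L t k * lkp (b i) k\<bar>)"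
      using sum_abs[of "\<lambda>k. L t k * lkp (b i) k" "{..<m}"] by simp
    also have "\<dots> \<le> (\<Sum>k<m. \<bar>L t k\<bar>)"
      using bk by (intro sum_mono) (auto simp: abs_mult mult_left_le)
    finally show ?thesis .
  qed
  \<comment> \<open>The common factor of all volumes. It will stand on both sides of the comparison,
    so its finiteness suffices.\<close>
  define c where "c = emeasure ?M (L -` (\<Pi>\<^sub>E i\<in>{..<m}. {0..1}) \<inter> space ?M)"
  have fin: "c < \<infinity>"
  proof -
    have "L -` (\<Pi>\<^sub>E i\<in>{..<m}. {0..1}) \<inter> space ?M \<subseteq> (\<Pi>\<^sub>E i\<in>{..<m}. {- real m..real m})"
    proof
      fix t assume t: "t \<in> L -` (\<Pi>\<^sub>E i\<in>{..<m}. {0..1}) \<inter> space ?M"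
      have "(\<Sum>k<m. \<bar>L t k\<bar>) \<le> (\<Sum>k<m. 1)"
        using t by (intro sum_mono) (auto simp: PiE_iff)
      then have "\<bar>t i\<bar> \<le> real m" if "i < m" for i using coord[OF that, of t] by simp
      then show "t \<in> (\<Pi>\<^sub>E i\<in>{..<m}. {- real m..real m})"
        using t by (auto simp: space_PiM PiE_iff abs_le_iff minus_le_iff)
    qed
    then have "c \<le> emeasure ?M (\<Pi>\<^sub>E i\<in>{..<m}. {- real m..real m})"
      unfolding c_def by (intro emeasure_mono sets_PiM_I_finite) auto
    also have "\<dots> < \<infinity>"
      by (subst emeasure_lebP_box) auto
    finally show ?thesis .
  qed
  have measL: "measure ?M (L -` X \<inter> space ?M) = enn2real c * measure ?M X" if "X \<in> sets ?M" for X
    by (simp add: measure_def pre[OF that] c_def enn2real_mult)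
  show thesis
  proof (rule that[of "enn2real c"])
    fix x A X
    assume X: "X \<in> sets ?M" "emeasure ?M X < \<infinity>"
      and AX: "\<And>t. t \<in> space ?M \<Longrightarrow> (\<Sum>i<m. t i *\<^sub>R unitv i) + x \<in> A \<Longrightarrow> t \<in> X"
    let ?A = "{t \<in> space ?M. T t + x \<in> A}"
    have sub: "?A \<subseteq> L -` X \<inter> space ?M"
      using AX[OF Lsp] by (auto simp: TL)
    show "vol (Rn m) x A \<le> enn2real c * measure ?M X"
    proof (cases "?A \<in> sets ?M")
      case True
      have "L -` X \<inter> space ?M \<in> fmeasurable ?M"
        using X fin measurable_sets[OF L X(1)] pre[OF X(1)]
        by (intro fmeasurableI) (auto simp: c_def[symmetric] ennreal_mult_less_top)
      with True sub have "measure ?M ?A \<le> measure ?M (L -` X \<inter> space ?M)"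
        by (intro measure_mono_fmeasurable)
      then show ?thesis by (simp add: vol_eq measL[OF X(1)])
    next
      case False
      \<comment> \<open>A set outside the sigma-algebra has \<open>measure\<close> 0 by
        convention.\<close>
      then show ?thesis by (simp add: vol_eq measure_notin_sets)
    qed
  next
    fix A X
    assume A: "compact A" and X: "X \<in> sets ?M"
      and XA: "\<And>t. t \<in> X \<Longrightarrow> (\<Sum>i<m. t i *\<^sub>R unitv i) \<in> A"
    let ?A = "{t \<in> space ?M. T t + 0 \<in> A}"
    have As: "?A \<in> sets ?M"
      unfolding T_def by (rule sets_lebP_closed_preimage[OF compact_imp_closed[OF A]])
    \<comment> \<open>Boundedness of \<open>A\<close> yields finite measure; without it
      \<open>measure\<close> would default to 0 and monotonicity would fail.\<close>
    obtain R where R: "\<And>z. z \<in> A \<Longrightarrow> norm z \<le> R" 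
      using compact_imp_bounded[OF A] by (auto simp: bounded_iff)
    have "?A \<subseteq> L -` (\<Pi>\<^sub>E i\<in>{..<m}. {- \<bar>R\<bar>..\<bar>R\<bar>}) \<inter> space ?M"
    proof
      fix t assume t: "t \<in> ?A"
      then have "\<bar>lkp (T t) i\<bar> \<le> \<bar>R\<bar>" for i
        using R[of "T t"] abs_lookup_le_norm[of "T t" i] by simp
      then have "\<bar>L t i\<bar> \<le> \<bar>R\<bar>" if "i < m" for i using that by (simp add: L_def)
      then show "t \<in> L -` (\<Pi>\<^sub>E i\<in>{..<m}. {- \<bar>R\<bar>..\<bar>R\<bar>}) \<inter> space ?M"
        using t Lsp[of t] by (auto simp: space_PiM PiE_iff abs_le_iff minus_le_iff)
    qed
    then have "emeasure ?M ?A \<le> emeasure ?M (L -` (\<Pi>\<^sub>E i\<in>{..<m}. {- \<bar>R\<bar>..\<bar>R\<bar>}) \<inter> space ?M)"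
      by (intro emeasure_mono measurable_sets[OF L] sets_PiM_I_finite) auto
    also have "\<dots> = c * emeasure ?M (\<Pi>\<^sub>E i\<in>{..<m}. {- \<bar>R\<bar>..\<bar>R\<bar>})"
      unfolding c_def by (intro pre sets_PiM_I_finite) auto
    also have "\<dots> < \<infinity>"
      using fin by (subst emeasure_lebP_box) (auto simp: ennreal_mult_less_top)
    finally have "?A \<in> fmeasurable ?M" by (intro fmeasurableI As)
    moreover have "L -` X \<inter> space ?M \<subseteq> ?A"
      using XA by (auto simp: TL)
    ultimately have "measure ?M (L -` X \<inter> space ?M) \<le> measure ?M ?A"
      using measurable_sets[OF L X] by (intro measure_mono_fmeasurable)
    also have "\<dots> = vol (Rn m) 0 (A \<inter> Rn m)"
      using TRn by (simp add: vol_eq)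
    finally show "enn2real c * measure ?M X \<le> vol (Rn m) 0 (A \<inter> Rn m)"
      by (simp add: measL[OF X])
  qed (simp add: fin)
qed

section \<open>Reduction to bounds on fibres and an inscribed cube\<close>

text \<open>The claim for fixed \<open>m\<close> and \<open>n\<close>, with \<open>a\<close> in the
  place of \<open>C * \<psi> m n\<close>.\<close>

definition large_difference_section :: "nat \<Rightarrow> nat \<Rightarrow> real \<Rightarrow> bool" where
  "large_difference_section m n a \<longleftrightarrow>
     (\<exists>K F. convex_body n K \<and> F \<subseteq> Rn n \<and> subspace F \<and> dim F = m \<and>
       (\<forall>x\<in>Rn n. vol F 0 (difference_body K \<inter> F) \<ge> a ^ m * vol F x (K \<inter> {y + x | y. y \<in> F})))"

text \<open>Take \<open>F = Rn m\<close>. The unknown factor in \<open>vol\<close> cancels, and what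
  remains is to compare \<open>(a * q) ^ m\<close> with the volume \<open>(2 * r) ^ m\<close> of a
  cube inside the difference body.\<close>

lemma large_difference_section_coordinates:
  assumes K: "convex_body n K" and mn: "m < n" and q: "q \<ge> 0" and r: "r \<ge> 0" and a: "a * q \<le> 2 * r" "a \<ge> 0"
    and fibre: "\<And>x. x \<in> Rn n \<Longrightarrow> \<exists>X\<in>sets (lebP {..<m}). emeasure (lebP {..<m}) X \<le> ennreal (q ^ m) \<and>
      (\<forall>t\<in>space (lebP {..<m}). (\<Sum>i<m. t i *\<^sub>R unitv i) + x \<in> K \<longrightarrow> t \<in> X)"
    and box: "\<And>z. z \<in> Rn m \<Longrightarrow> (\<And>i. i < m \<Longrightarrow> \<bar>lkp z i\<bar> \<le> r) \<Longrightarrow> z \<in> difference_body K"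
  shows "large_difference_section m n a"
  unfolding large_difference_section_def
proof (intro exI conjI ballI)
  let ?M = "lebP {..<m}"
  obtain c where c: "c \<ge> 0"
    and upper: "\<And>x A X. X \<in> sets ?M \<Longrightarrow> emeasure ?M X < \<infinity> \<Longrightarrow>
      (\<And>t. t \<in> space ?M \<Longrightarrow> (\<Sum>i<m. t i *\<^sub>R unitv i) + x \<in> A \<Longrightarrow> t \<in> X) \<Longrightarrow>
      vol (Rn m) x A \<le> c * measure ?M X"
    and lower: "\<And>A X. compact A \<Longrightarrow> X \<in> sets ?M \<Longrightarrow>
      (\<And>t. t \<in> X \<Longrightarrow> (\<Sum>i<m. t i *\<^sub>R unitv i) \<in> A) \<Longrightarrow>
      c * measure ?M X \<le> vol (Rn m) 0 (A \<inter> Rn m)"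
    by (rule vol_Rn_coordinates[of m]) blast
  show "convex_body n K" by (rule K)
  show "Rn m \<subseteq> Rn n" using mn by (intro Rn_mono) simp
  show "subspace (Rn m)" "dim (Rn m) = m" by (rule subspace_Rn dim_Rn)+
  fix x assume x: "x \<in> Rn n"
  obtain X where X: "X \<in> sets ?M" "emeasure ?M X \<le> ennreal (q ^ m)"
    "\<And>t. t \<in> space ?M \<Longrightarrow> (\<Sum>i<m. t i *\<^sub>R unitv i) + x \<in> K \<Longrightarrow> t \<in> X"
    using fibre[OF x] by blast
  have "vol (Rn m) x (K \<inter> {y + x | y. y \<in> Rn m}) \<le> c * measure ?M X"
    using X by (intro upper) (auto intro: le_less_trans)
  also have "\<dots> \<le> c * q ^ m"
    using X(2) q c by (intro mult_left_mono) (auto simp: measure_def intro: enn2real_leI)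
  finally have "a ^ m * vol (Rn m) x (K \<inter> {y + x | y. y \<in> Rn m}) \<le> a ^ m * (c * q ^ m)"
    using a by (intro mult_left_mono) auto
  also have "\<dots> = c * (a * q) ^ m" by (simp add: power_mult_distrib)
  also have "\<dots> \<le> c * (2 * r) ^ m"
    using a q c by (intro mult_left_mono power_mono) auto
  also have "(2 * r) ^ m = measure ?M (\<Pi>\<^sub>E i\<in>{..<m}. {- r..r})"
    using r emeasure_lebP_box[of m "\<lambda>_. - r" "\<lambda>_. r"] by (simp add: measure_def)
  also have "c * \<dots> \<le> vol (Rn m) 0 (difference_body K \<inter> Rn m)"
  proof (rule lower)
    show "compact (difference_body K)"
      using K compact_differences[of K K] by (simp add: convex_body_def difference_body_def)
    fix t assume t: "t \<in> (\<Pi>\<^sub>E i\<in>{..<m}. {- r..r})"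
    show "(\<Sum>i<m. t i *\<^sub>R unitv i) \<in> difference_body K"
    proof (rule box)
      show "(\<Sum>i<m. t i *\<^sub>R unitv i) \<in> Rn m"
        by (simp add: Rn_iff lookup_sum_unitv)
      fix i assume "i < m"
      then show "\<bar>lkp (\<Sum>i<m. t i *\<^sub>R unitv i) i\<bar> \<le> r"
        using t by (auto simp: lookup_sum_unitv PiE_iff abs_le_iff minus_le_iff)
    qed
  qed (auto intro!: sets_PiM_I_finite)
  finally show "a ^ m * vol (Rn m) x (K \<inter> {y + x | y. y \<in> Rn m}) \<le> vol (Rn m) 0 (difference_body K \<inter> Rn m)" .
qed

section \<open>The bodies\<close>

text \<open>The average \<open>p\<close> of the segment centres is interior: a small displacement of
  \<open>p\<close> is obtained by moving the \<open>i\<close>-th centre along its segment by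
  \<open>n\<close> times the \<open>i\<close>-th coordinate, the factor \<open>n\<close> offsetting
  the weight \<open>1 / n\<close>.\<close>

lemma convex_body_hull:
  assumes V: "finite V" "V \<subseteq> Rn n" and n: "n > 0"
    and seg: "\<And>i. i < n \<Longrightarrow> \<exists>c. \<exists>\<epsilon>>0. c + \<epsilon> *\<^sub>R unitv i \<in> convex hull V \<and> c - \<epsilon> *\<^sub>R unitv i \<in> convex hull V"
  shows "convex_body n (convex hull V)"
proof -
  let ?K = "convex hull V"
  have KRn: "?K \<subseteq> Rn n"
    by (rule hull_minimal) (use V subspace_imp_convex[OF subspace_Rn] in auto)
  obtain c \<epsilon> where c\<epsilon>: "\<And>i. i < n \<Longrightarrow> \<epsilon> i > 0 \<and> c i + \<epsilon> i *\<^sub>R unitv i \<in> ?K \<and> c i - \<epsilon> i *\<^sub>R unitv i \<in> ?K"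
    using seg by metis
  define \<delta> where "\<delta> = Min (\<epsilon> ` {..<n}) / real n"
  have \<delta>: "\<delta> > 0"
  proof -
    have "Min (\<epsilon> ` {..<n}) > 0"
      using n c\<epsilon> by (subst Min_gr_iff) (auto simp: lessThan_empty_iff)
    then show ?thesis using n by (simp add: \<delta>_def)
  qed
  have \<delta>i: "real n * \<delta> \<le> \<epsilon> i" if "i < n" for i
    using n that by (simp add: \<delta>_def)
  have perturb: "c i + s *\<^sub>R unitv i \<in> ?K" if i: "i < n" and s: "\<bar>s\<bar> \<le> \<epsilon> i" for i s
  proof -
    \<comment> \<open>The barycentric weight of the point \<open>c i + s *\<^sub>R unitv i\<close>
      on its segment.\<close>
    define u where "u = (1 + s / \<epsilon> i) / 2"
    have \<epsilon>: "\<epsilon> i > 0" using c\<epsilon>[OF i] by simp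
    then have "s / \<epsilon> i \<le> 1" "- 1 \<le> s / \<epsilon> i" using s by (simp_all add: abs_le_iff field_simps)
    then have u: "0 \<le> u" "0 \<le> 1 - u" by (simp_all add: u_def)
    have "u *\<^sub>R (c i + \<epsilon> i *\<^sub>R unitv i) + (1 - u) *\<^sub>R (c i - \<epsilon> i *\<^sub>R unitv i) \<in> ?K"
      using c\<epsilon>[OF i] u by (intro convexD[OF convex_convex_hull]) auto
    also have "u *\<^sub>R (c i + \<epsilon> i *\<^sub>R unitv i) + (1 - u) *\<^sub>R (c i - \<epsilon> i *\<^sub>R unitv i)
        = c i + ((2 * u - 1) * \<epsilon> i) *\<^sub>R unitv i"
      by (rule poly_mapping_eqI) (simp only: lookup_add lookup_minus lookup_scaleR, simp add: algebra_simps)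
    also have "(2 * u - 1) * \<epsilon> i = s" using \<epsilon> by (simp add: u_def field_simps)
    finally show ?thesis .
  qed
  define p where "p = (\<Sum>i<n. (1 / real n) *\<^sub>R c i)"
  have "z \<in> ?K" if z: "z \<in> Rn n" and d: "dist p z < \<delta>" for z
  proof -
    have "c i \<in> Rn n" if "i < n" for i
      using perturb[OF that, of 0] c\<epsilon>[OF that] KRn by auto
    then have "p \<in> Rn n"
      unfolding p_def by (intro subspace_sum[OF subspace_Rn] subspace_scale[OF subspace_Rn]) auto
    then have zp: "z - p \<in> Rn n" using z by (intro subspace_diff[OF subspace_Rn])
    have small: "c i + (real n * lkp (z - p) i) *\<^sub>R unitv i \<in> ?K" if i: "i < n" for i
    proof (rule perturb[OF i])
      have "\<bar>lkp (z - p) i\<bar> \<le> \<delta>"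
        using abs_lookup_le_norm[of "z - p" i] d by (simp add: dist_norm norm_minus_commute)
      then have "real n * \<bar>lkp (z - p) i\<bar> \<le> real n * \<delta>" by (intro mult_left_mono) auto
      also have "\<dots> \<le> \<epsilon> i" by (rule \<delta>i[OF i])
      finally show "\<bar>real n * lkp (z - p) i\<bar> \<le> \<epsilon> i" by (simp add: abs_mult)
    qed
    have "(\<Sum>i<n. (1 / real n) *\<^sub>R (c i + (real n * lkp (z - p) i) *\<^sub>R unitv i)) \<in> ?K"
      using n small by (intro convex_sum convex_convex_hull) auto
    also have "(\<Sum>i<n. (1 / real n) *\<^sub>R (c i + (real n * lkp (z - p) i) *\<^sub>R unitv i))
        = p + (\<Sum>i<n. lkp (z - p) i *\<^sub>R unitv i)"
      using n by (simp add: p_def scaleR_add_right sum.distrib)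
    also have "\<dots> = z" unfolding Rn_expansion[OF zp] by simp
    finally show ?thesis .
  qed
  then have sub: "Rn n \<inter> ball p \<delta> \<subseteq> ?K" by auto
  have "p \<in> ?K"
    unfolding p_def using n perturb[of _ 0] c\<epsilon> by (intro convex_sum convex_convex_hull) (auto simp: less_imp_le)
  then have "p \<in> Rn n \<inter> ball p \<delta>" using KRn \<delta> by auto
  moreover have "openin (top_of_set (Rn n)) (Rn n \<inter> ball p \<delta>)"
    by (simp add: openin_open_Int)
  ultimately have "p \<in> (top_of_set (Rn n)) interior_of ?K"
    using sub unfolding interior_of_def by blast
  then show ?thesis
    unfolding convex_body_def
    using KRn finite_imp_compact_convex_hull[OF V(1)] convex_convex_hull by blast
qed

definition signvec :: "nat set \<Rightarrow> nat set \<Rightarrow> (nat \<Rightarrow>\<^sub>0 real)" where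
  "signvec I S = (\<Sum>i\<in>I. sgv S i *\<^sub>R unitv i)"

lemma lookup_signvec:
  assumes "finite I"
  shows "lkp (signvec I S) k = (if k \<in> I then sgv S k else 0)"
proof -
  have "lkp (signvec I S) k = (\<Sum>i\<in>I. if i = k then sgv S k else 0)"
    unfolding signvec_def lookup_sum by (rule sum.cong) (auto simp: lookup_unitv)
  then show ?thesis using assms by simp
qed

text \<open>Induction on the dimension: a point with \<open>j\<close>-th coordinate \<open>a\<close>
  is the mixture, with weights \<open>(1 + a) / 2\<close> and \<open>(1 - a) / 2\<close>, of its
  projections to the two faces where that coordinate is 1 and -1.\<close>

lemma cube_subset_hull_signvec:
  assumes "finite I" "Poly_Mapping.keys z \<subseteq> I" "\<And>i. i \<in> I \<Longrightarrow> \<bar>lkp z i\<bar> \<le> 1"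
  shows "z \<in> convex hull (signvec I ` Pow I)"
  using assms
proof (induction I arbitrary: z rule: finite_induct)
  case empty
  then have "z = 0" by simp
  then show ?case by (simp add: signvec_def)
next
  case (insert j I)
  define a where "a = lkp z j"
  define y where "y = z - a *\<^sub>R unitv j"
  have y: "lkp y i = (if i = j then 0 else lkp z i)" for i
    by (simp add: y_def a_def lookup_minus lookup_unitv)
  have "y \<in> convex hull (signvec I ` Pow I)"
  proof (rule insert.IH)
    show "Poly_Mapping.keys y \<subseteq> I"
      using insert.prems(1) by (auto simp: in_keys_iff y subset_iff split: if_splits)
    show "\<bar>lkp y i\<bar> \<le> 1" if "i \<in> I" for i
      using insert.prems(2)[of i] that by (simp add: y)
  qed
  then have shift: "s *\<^sub>R unitv j + y \<in> convex hull (signvec (insert j I) ` Pow (insert j I))"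
    if s: "s = 1 \<or> s = - 1" for s
  proof -
    have "(+) (s *\<^sub>R unitv j) ` signvec I ` Pow I \<subseteq> signvec (insert j I) ` Pow (insert j I)"
    proof safe
      fix S assume S: "S \<subseteq> I"
      let ?S = "if s = 1 then insert j S else S"
      have "s *\<^sub>R unitv j + signvec I S = signvec (insert j I) ?S"
        using insert.hyps S s
        by (intro poly_mapping_eqI) (auto simp: lookup_add lookup_signvec lookup_unitv sgv_def)
      then show "s *\<^sub>R unitv j + signvec I S \<in> signvec (insert j I) ` Pow (insert j I)"
        by (rule image_eqI) (use S in auto)
    qed
    from hull_mono[OF this, of convex] show ?thesis
      using \<open>y \<in> _\<close> by (auto simp: convex_hull_translation)
  qed
  have a: "\<bar>a\<bar> \<le> 1" using insert.prems(2)[of j] by (simp add: a_def)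
  have "((1 + a) / 2) *\<^sub>R (1 *\<^sub>R unitv j + y) + ((1 - a) / 2) *\<^sub>R ((- 1) *\<^sub>R unitv j + y)
      \<in> convex hull (signvec (insert j I) ` Pow (insert j I))"
    using a by (intro convexD[OF convex_convex_hull] shift) (auto simp: abs_le_iff field_simps)
  also have "((1 + a) / 2) *\<^sub>R (1 *\<^sub>R unitv j + y) + ((1 - a) / 2) *\<^sub>R ((- 1) *\<^sub>R unitv j + y) = z"
    by (rule poly_mapping_eqI) (simp only: y_def lookup_add lookup_minus lookup_scaleR, simp add: field_simps)
  finally show ?case .
qed

section \<open>Bodies with zonotope fibres\<close>

lemma convex_le_linear: "linear (f :: (nat \<Rightarrow>\<^sub>0 real) \<Rightarrow> real) \<Longrightarrow> convex {z. f z \<le> a}"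
  using convex_linear_vimage[of f "{..a}"] by (simp add: vimage_def)

lemma hull_le_linear:
  assumes "linear (f :: (nat \<Rightarrow>\<^sub>0 real) \<Rightarrow> real)" "\<And>v. v \<in> V \<Longrightarrow> f v \<le> a" "z \<in> convex hull V"
  shows "f z \<le> a"
  using hull_minimal[of V "{z. f z \<le> a}" convex] convex_le_linear[OF assms(1), of a] assms(2,3) by auto

text \<open>The simplex with vertices \<open>0\<close> and \<open>unitv q\<close>, \<open>m \<le> q < n\<close>, carries over \<open>unitv q\<close> the segment
  from \<open>- v q\<close> to \<open>v q\<close>. Every fibre is then a zonotope \<open>\<Sum>q. l q *\<^sub>R [- v q, v q]\<close> with \<open>sum l \<le> 1\<close>,
  whereas the differences of points in a common fibre fill \<open>2 *\<^sub>R convex hull W\<close>.\<close>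

lemma large_difference_section_zonotopes:
  assumes m: "1 \<le> m" and mn: "m < n" and v: "v ` {m..<n} = W" and W: "W \<subseteq> Rn m"
    and len: "\<And>w. w \<in> W \<Longrightarrow> (\<Sum>i<m. (lkp w i)\<^sup>2) \<le> d" and d: "d > 0"
    and box: "\<And>z. z \<in> Rn m \<Longrightarrow> (\<And>i. i < m \<Longrightarrow> \<bar>lkp z i\<bar> \<le> \<rho>) \<Longrightarrow> z \<in> convex hull W"
    and \<rho>: "\<rho> > 0" and a: "a * (2 * exp 1 * sqrt d / real m) \<le> 4 * \<rho>" "a \<ge> 0"
  shows "large_difference_section m n a"
proof -
  define V where "V = insert 0 ((\<lambda>q. unitv q + v q) ` {m..<n} \<union> (\<lambda>q. unitv q - v q) ` {m..<n})"
  define K where "K = convex hull V"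
  have convK: "convex K" by (simp add: K_def)
  have vRn: "v q \<in> Rn m" if "q \<in> {m..<n}" for q using that v W by auto
  have Vin: "0 \<in> K" "q \<in> {m..<n} \<Longrightarrow> unitv q + v q \<in> K" "q \<in> {m..<n} \<Longrightarrow> unitv q - v q \<in> K" for q
    by (auto simp: K_def V_def intro!: hull_inc)
  have unitK: "unitv q \<in> K" if q: "q \<in> {m..<n}" for q
  proof -
    have "(1/2) *\<^sub>R (unitv q + v q) + (1/2) *\<^sub>R (unitv q - v q) \<in> K"
      using Vin q by (intro convexD[OF convK]) auto
    also have "(1/2) *\<^sub>R (unitv q + v q) + (1/2) *\<^sub>R (unitv q - v q) = unitv q"
      by (rule poly_mapping_eqI) (simp only: lookup_add lookup_minus lookup_scaleR, simp add: field_simps)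
    finally show ?thesis .
  qed
  \<comment> \<open>The vectors \<open>z\<close> that are half-differences about some centre
    \<open>l\<close> form a convex set; it contains \<open>W\<close>, hence the hull of
    \<open>W\<close>.\<close>
  have lift: "\<exists>l. l + z \<in> K \<and> l - z \<in> K" if "z \<in> convex hull W" for z
  proof -
    have "convex {z. \<exists>l. l + z \<in> K \<and> l - z \<in> K}"
    proof (rule convexI, safe)
      fix x y l k and s t :: real
      assume st: "0 \<le> s" "0 \<le> t" "s + t = 1" and l: "l + x \<in> K" "l - x \<in> K" and k: "k + y \<in> K" "k - y \<in> K"
      have "s *\<^sub>R (l + x) + t *\<^sub>R (k + y) \<in> K" "s *\<^sub>R (l - x) + t *\<^sub>R (k - y) \<in> K"
        using convexD[OF convK] st l k by blast+
      then show "\<exists>l. l + (s *\<^sub>R x + t *\<^sub>R y) \<in> K \<and> l - (s *\<^sub>R x + t *\<^sub>R y) \<in> K"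
        by (intro exI[of _ "s *\<^sub>R l + t *\<^sub>R k"]) (simp add: algebra_simps)
    qed
    moreover have "W \<subseteq> {z. \<exists>l. l + z \<in> K \<and> l - z \<in> K}"
      unfolding v[symmetric] using Vin(2,3) by blast
    ultimately show ?thesis using hull_minimal[of W _ convex] that by blast
  qed
  show ?thesis
  proof (rule large_difference_section_coordinates)
    show "convex_body n K"
      unfolding K_def
    proof (rule convex_body_hull)
      show "finite V" by (simp add: V_def)
      show "V \<subseteq> Rn n"
        using vRn Rn_mono[of m n] mn unfolding V_def
        by (auto intro!: subspace_add[OF subspace_Rn] subspace_diff[OF subspace_Rn] unitv_Rn
            simp: subspace_0[OF subspace_Rn])
      show "n > 0" using mn by simp
      fix i assume i: "i < n"
      show "\<exists>c. \<exists>\<epsilon>>0. c + \<epsilon> *\<^sub>R unitv i \<in> convex hull V \<and> c - \<epsilon> *\<^sub>R unitv i \<in> convex hull V"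
      proof (cases "i < m")
        case True
        have "\<rho> *\<^sub>R unitv i \<in> convex hull W"
        proof (rule box)
          show "\<rho> *\<^sub>R unitv i \<in> Rn m"
            using True by (intro subspace_scale[OF subspace_Rn] unitv_Rn)
          show "\<bar>lkp (\<rho> *\<^sub>R unitv i) k\<bar> \<le> \<rho>" for k
            using \<rho> by (cases "k = i") (auto simp: lookup_unitv)
        qed
        then show ?thesis using lift[of "\<rho> *\<^sub>R unitv i"] \<rho> unfolding K_def by blast
      next
        case False
        \<comment> \<open>Outside \<open>F\<close>, the edge from \<open>0\<close> to
          \<open>unitv i\<close> serves, with its midpoint as centre.\<close>
        then have "unitv i \<in> K" using i unitK by auto
        moreover have "(1/2) *\<^sub>R unitv i + (1/2) *\<^sub>R unitv i = unitv i"
          by (simp flip: scaleR_add_left)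
        ultimately show ?thesis using Vin(1) unfolding K_def
          by (intro exI[of _ "(1/2) *\<^sub>R unitv i"] exI[of _ "1/2"]) auto
      qed
    qed
    show "m < n" by (rule mn)
    show "2 * exp 1 * sqrt d / real m \<ge> 0" "2 * \<rho> \<ge> 0" using d \<rho> by auto
    show "a * (2 * exp 1 * sqrt d / real m) \<le> 2 * (2 * \<rho>)" "a \<ge> 0" using a by auto
  next
    fix z assume z: "z \<in> Rn m" "\<And>i. i < m \<Longrightarrow> \<bar>lkp z i\<bar> \<le> 2 * \<rho>"
    have "(1/2) *\<^sub>R z \<in> convex hull W"
      using z by (intro box subspace_scale[OF subspace_Rn]) (auto simp: mult.commute)
    then obtain l where "l + (1/2) *\<^sub>R z \<in> K" "l - (1/2) *\<^sub>R z \<in> K" using lift by blast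
    moreover have "z = (l + (1/2) *\<^sub>R z) - (l - (1/2) *\<^sub>R z)"
      by (rule poly_mapping_eqI) (simp only: lookup_add lookup_minus lookup_scaleR)
    ultimately show "z \<in> difference_body K" unfolding difference_body_def by blast
  next
    fix x assume x: "x \<in> Rn n"
    let ?M = "lebP {..<m}"
    let ?q = "2 * exp 1 * sqrt d / real m"
    show "\<exists>X\<in>sets ?M. emeasure ?M X \<le> ennreal (?q ^ m) \<and>
        (\<forall>t\<in>space ?M. (\<Sum>i<m. t i *\<^sub>R unitv i) + x \<in> K \<longrightarrow> t \<in> X)"
    proof (cases "\<exists>t\<in>space ?M. (\<Sum>i<m. t i *\<^sub>R unitv i) + x \<in> K")
      case False
      then show ?thesis by (intro bexI[of _ "{}"]) auto
    next
      case True
      have lk: "lkp ((\<Sum>i<m. t i *\<^sub>R unitv i) + x) k = (if k < m then t k else 0) + lkp x k" for t k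
        by (simp add: lookup_add lookup_sum_unitv)
      have Vlk: "lkp (unitv q + v q) k = (if k = q then 1 else 0) + lkp (v q) k"
        "lkp (unitv q - v q) k = (if k = q then 1 else 0) - lkp (v q) k" for q k
        by (auto simp: lookup_add lookup_minus lookup_unitv)
      have vq0: "lkp (v q) k = 0" if "q \<in> {m..<n}" "k \<ge> m" for q k
        using vRn[OF that(1)] that(2) by (simp add: Rn_iff)
      \<comment> \<open>\<open>g S q\<close> is the support function of the segment from
        \<open>- v q\<close> to \<open>v q\<close> at the sign vector \<open>S\<close>. That
        \<open>f S\<close> is at most 0 on \<open>K\<close> says that the support function of a
        fibre is at most the weighted sum of these; it is enough to check the vertices.\<close>
      define g where "g S q = \<bar>\<Sum>i<m. sgv S i * lkp (v q) i\<bar>" for S q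
      define f where "f S z = (\<Sum>i<m. sgv S i * lkp z i) - (\<Sum>q\<in>{m..<n}. lkp z q * g S q)" for S z
      have linf: "linear (f S)" for S
        by (intro linearI) (simp_all add: f_def lookup_add algebra_simps sum.distrib sum_distrib_left)
      have "f S z \<le> 0" if "z \<in> V" for S z
      proof -
        have "(\<Sum>i<m. sgv S i * lkp z i) \<le> g S q \<and> (\<Sum>q\<in>{m..<n}. lkp z q * g S q) = g S q"
          if q: "q \<in> {m..<n}" and z: "z = unitv q + v q \<or> z = unitv q - v q" for q
        proof
          have "(\<Sum>i<m. sgv S i * lkp z i) = (\<Sum>i<m. sgv S i * lkp (v q) i) \<or>
              (\<Sum>i<m. sgv S i * lkp z i) = (\<Sum>i<m. - (sgv S i * lkp (v q) i))"
            using z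
          proof (elim disjE)
            assume "z = unitv q + v q"
            then show ?thesis using q by (intro disjI1 sum.cong) (auto simp: Vlk)
          next
            assume "z = unitv q - v q"
            then show ?thesis using q by (intro disjI2 sum.cong) (auto simp: Vlk)
          qed
          then show "(\<Sum>i<m. sgv S i * lkp z i) \<le> g S q"
            by (auto simp: g_def sum_negf)
          have "(\<Sum>k\<in>{m..<n}. lkp z k * g S k) = (\<Sum>k\<in>{m..<n}. if k = q then g S q else 0)"
            using z vq0[OF q] by (intro sum.cong) (auto simp: Vlk)
          then show "(\<Sum>q\<in>{m..<n}. lkp z q * g S q) = g S q" using q by simp
        qed
        then show ?thesis using that by (auto simp: f_def V_def)
      qed
      then have fK: "f S z \<le> 0" if "z \<in> K" for S z
        using that hull_le_linear[OF linf] unfolding K_def by blast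
      have pos: "lkp z q \<ge> 0" if "z \<in> K" "q \<ge> m" for z q
      proof -
        have "- lkp z q \<le> 0"
        proof (rule hull_le_linear)
          show "linear (\<lambda>z. - lkp z q)" by (intro linear_compose_neg linear_lookup)
          show "z \<in> convex hull V" using that by (simp add: K_def)
          show "- lkp u q \<le> 0" if "u \<in> V" for u
            using that vq0 \<open>q \<ge> m\<close> by (auto simp: V_def Vlk)
        qed
        then show ?thesis by simp
      qed
      have sum1: "(\<Sum>q\<in>{m..<n}. lkp z q) \<le> 1" if "z \<in> K" for z
      proof (rule hull_le_linear)
        show "linear (\<lambda>z. \<Sum>q\<in>{m..<n}. lkp z q)" by (intro linear_compose_sum ballI linear_lookup)
        show "z \<in> convex hull V" using that by (simp add: K_def)
        show "(\<Sum>q\<in>{m..<n}. lkp u q) \<le> 1" if u: "u \<in> V" for u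
        proof (cases "u = 0")
          case False
          then obtain p where p: "p \<in> {m..<n}" "u = unitv p + v p \<or> u = unitv p - v p"
            using u by (auto simp: V_def)
          then have "(\<Sum>q\<in>{m..<n}. lkp u q) = (\<Sum>q\<in>{m..<n}. if q = p then 1 else 0)"
            using vq0[OF p(1)] by (intro sum.cong) (auto simp: Vlk)
          then show ?thesis by simp
        qed simp
      qed
      \<comment> \<open>The fibre is nonempty, so the coordinates of \<open>x\<close> from
        \<open>m\<close> on obey the constraints of the simplex; they are the weights of the
        zonotope.\<close>
      have xpos: "lkp x q \<ge> 0" if "q \<ge> m" for q
        using True pos[OF _ that] lk[of _ q] that by fastforce
      have xsum: "(\<Sum>q\<in>{m..<n}. lkp x q) \<le> 1"
      proof -
        obtain t where "(\<Sum>i<m. t i *\<^sub>R unitv i) + x \<in> K" using True by blast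
        from sum1[OF this] show ?thesis by (simp add: lk)
      qed
      \<comment> \<open>The fibre is described by \<open>t\<close>, not \<open>t + x\<close>; this
        shift contributes a linear term, which averages to zero.\<close>
      define H where "H S = (\<Sum>q\<in>{m..<n}. lkp x q * g S q) - (\<Sum>i<m. sgv S i * lkp x i)" for S
      have "(\<Sum>S\<in>Pow {..<m}. H S)
          = (\<Sum>q\<in>{m..<n}. lkp x q * (\<Sum>S\<in>Pow {..<m}. g S q))"
        using sum_Pow_sgv_linear[of "{..<m}" "lkp x"]
        by (simp add: H_def sum_subtractf sum_distrib_left sum.swap[of _ "{m..<n}"])
      \<comment> \<open>Each segment has mean width at most \<open>sqrt d\<close>, and the total
        weight is at most 1, so the whole fibre obeys the same bound.\<close>
      also have "\<dots> \<le> (\<Sum>q\<in>{m..<n}. lkp x q * (2 ^ m * sqrt d))"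
      proof (intro sum_mono mult_left_mono)
        fix q assume q: "q \<in> {m..<n}"
        then have "v q \<in> W" using v by blast
        from len[OF this] show "(\<Sum>S\<in>Pow {..<m}. g S q) \<le> 2 ^ m * sqrt d"
          using sum_Pow_abs_sgv_le[of "{..<m}" "lkp (v q)" d] by (simp add: g_def)
        show "0 \<le> lkp x q" using q by (intro xpos) auto
      qed
      also have "\<dots> = (\<Sum>q\<in>{m..<n}. lkp x q) * (2 ^ m * sqrt d)"
        by (simp add: sum_distrib_right)
      also have "\<dots> \<le> 1 * (2 ^ m * sqrt d)"
        using xsum d by (intro mult_right_mono) auto
      finally have sumH: "(\<Sum>S\<in>Pow {..<m}. H S) \<le> 2 ^ card {..<m} * sqrt d" by simp
      have "emeasure ?M (sign_polytope {..<m} H)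
          \<le> ennreal ((2 * exp 1 * sqrt d / real (card {..<m})) ^ card {..<m})"
        using m d sumH by (intro emeasure_sign_polytope_le) (auto simp: lessThan_empty_iff)
      moreover have "t \<in> sign_polytope {..<m} H"
        if t: "t \<in> space ?M" "(\<Sum>i<m. t i *\<^sub>R unitv i) + x \<in> K" for t
      proof -
        have "(\<Sum>i<m. sgv S i * t i) \<le> H S" for S
        proof -
          have "(\<Sum>i<m. sgv S i * (t i + lkp x i)) - (\<Sum>q\<in>{m..<n}. lkp x q * g S q) \<le> 0"
            using fK[OF t(2), of S] by (simp add: f_def lk)
          then show ?thesis by (simp add: H_def algebra_simps sum.distrib)
        qed
        then show ?thesis using t by (simp add: sign_polytope_def)
      qed
      ultimately show ?thesis
        by (intro bexI[of _ "sign_polytope {..<m} H"] sets_sign_polytope) auto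
    qed
  qed
qed

section \<open>Vertices of cubes over blocks of coordinates\<close>

text \<open>Consecutive intervals, the last possibly shorter. For positive \<open>m\<close> and
  \<open>d\<close> the nonempty blocks are those with \<open>j\<close> up to
  \<open>(m - 1) div d\<close>.\<close>

definition block :: "nat \<Rightarrow> nat \<Rightarrow> nat \<Rightarrow> nat set" where
  "block m d j = {i. i < m \<and> i div d = j}"

lemma finite_block [simp]: "finite (block m d j)"
  by (rule finite_subset[of _ "{..<m}"]) (auto simp: block_def)

lemma card_block_le: "d > 0 \<Longrightarrow> card (block m d j) \<le> d"
proof -
  assume d: "d > 0"
  have "block m d j \<subseteq> {j * d..<j * d + d}"
  proof
    fix i assume "i \<in> block m d j"
    then have "i div d = j" by (simp add: block_def)
    then have "i = j * d + i mod d" using div_mult_mod_eq[of i d] by simp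
    then show "i \<in> {j * d..<j * d + d}" using mod_less_divisor[OF d, of i] by simp
  qed
  then have "card (block m d j) \<le> card {j * d..<j * d + d}" by (intro card_mono) auto
  then show ?thesis by simp
qed

text \<open>The \<open>v q\<close> are the vertices of the cubes over the blocks: at most
  \<open>B * 2 ^ d\<close> vectors of squared length at most \<open>d\<close>, few enough to be
  indexed by the \<open>n - m\<close> extra coordinates. Averaging over the blocks costs a factor
  \<open>B\<close>, which leaves a cube of half-side \<open>1 / B\<close> in their hull.\<close>

lemma large_difference_section_blocks:
  assumes m: "1 \<le> m" and d: "1 \<le> d" and B: "B = (m - 1) div d + 1" and n: "m + B * 2 ^ d \<le> n"
    and a: "a * (2 * exp 1 * sqrt (real d) / real m) \<le> 4 / real B" "a \<ge> 0"
  shows "large_difference_section m n a"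
proof -
  define W where "W = (\<Union>j<B. signvec (block m d j) ` Pow (block m d j))"
  have B0: "B > 0" using B by simp
  have blockB: "i div d < B" if "i < m" for i
  proof -
    have "i \<le> m - 1" using that by simp
    then have "i div d \<le> (m - 1) div d" by (rule div_le_mono)
    then show ?thesis by (simp add: B)
  qed
  have finW: "finite W" by (simp add: W_def)
  have "card W \<le> (\<Sum>j<B. card (signvec (block m d j) ` Pow (block m d j)))"
    unfolding W_def by (rule card_UN_le) simp
  also have "\<dots> \<le> (\<Sum>j<B. 2 ^ d)"
  proof (rule sum_mono)
    fix j
    have "card (signvec (block m d j) ` Pow (block m d j)) \<le> card (Pow (block m d j))"
      by (rule card_image_le) simp
    also have "\<dots> = 2 ^ card (block m d j)" by (simp add: card_Pow)
    also have "\<dots> \<le> 2 ^ d" using d by (intro power_increasing card_block_le) auto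
    finally show "card (signvec (block m d j) ` Pow (block m d j)) \<le> 2 ^ d" .
  qed
  finally have cardW: "card W \<le> card {m..<n}" using n by simp
  have ne: "signvec (block m d 0) {} \<in> W" using B0 by (auto simp: W_def)
  obtain f where f: "f ` W \<subseteq> {m..<n}" "inj_on f W"
    using card_le_inj[OF finW _ cardW] by auto
  \<comment> \<open>Surplus indices repeat one fixed vertex.\<close>
  define v where "v q = (if q \<in> f ` W then inv_into W f q else signvec (block m d 0) {})" for q
  have v: "v ` {m..<n} = W"
  proof
    show "v ` {m..<n} \<subseteq> W" using ne by (auto simp: v_def inv_into_into)
    show "W \<subseteq> v ` {m..<n}"
    proof
      fix w assume w: "w \<in> W"
      then have "v (f w) = w" using f(2) by (simp add: v_def)
      moreover have "f w \<in> {m..<n}" using f(1) w by blast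
      ultimately show "w \<in> v ` {m..<n}" by (metis image_eqI)
    qed
  qed
  show ?thesis
  proof (rule large_difference_section_zonotopes[OF m _ v])
    have "B * 2 ^ d > 0" using B0 by simp
    then show "m < n" using n by linarith
    show "W \<subseteq> Rn m" by (auto simp: W_def Rn_iff lookup_signvec block_def)
    show "(\<Sum>i<m. (lkp w i)\<^sup>2) \<le> real d" if wW: "w \<in> W" for w
    proof -
      obtain j S where w: "w = signvec (block m d j) S" using wW unfolding W_def by blast
      have "(\<Sum>i<m. (lkp w i)\<^sup>2) = (\<Sum>i<m. if i \<in> block m d j then 1 else 0)"
        by (rule sum.cong) (auto simp: w lookup_signvec sgv_def)
      also have "\<dots> = (\<Sum>i\<in>{..<m} \<inter> block m d j. 1)"
        by (rule sum.inter_restrict[symmetric]) simp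
      also have "{..<m} \<inter> block m d j = block m d j" by (auto simp: block_def)
      also have "(\<Sum>i\<in>block m d j. 1) \<le> real d" using card_block_le[of d m j] d by simp
      finally show ?thesis .
    qed
    show "real d > 0" using d by simp
    show "1 / real B > 0" using B0 by simp
    show "a * (2 * exp 1 * sqrt (real d) / real m) \<le> 4 * (1 / real B)" "a \<ge> 0" using a by simp_all
    fix z assume z: "z \<in> Rn m" "\<And>i. i < m \<Longrightarrow> \<bar>lkp z i\<bar> \<le> 1 / real B"
    \<comment> \<open>\<open>z\<close> is the average of the \<open>y j\<close>, each being
      \<open>B\<close> times the part of \<open>z\<close> in block \<open>j\<close>; the bound
      \<open>1 / B\<close> puts it into the cube over that block.\<close>
    define y where "y j = (\<Sum>i\<in>block m d j. (real B * lkp z i) *\<^sub>R unitv i)" for j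
    have y: "lkp (y j) k = (if k \<in> block m d j then real B * lkp z k else 0)" for j k
    proof -
      have "lkp (y j) k = (\<Sum>i\<in>block m d j. if i = k then real B * lkp z k else 0)"
        unfolding y_def lookup_sum by (rule sum.cong) (auto simp: lookup_unitv)
      then show ?thesis by simp
    qed
    have "y j \<in> convex hull W" if "j < B" for j
    proof -
      have "y j \<in> convex hull (signvec (block m d j) ` Pow (block m d j))"
      proof (rule cube_subset_hull_signvec)
        show "Poly_Mapping.keys (y j) \<subseteq> block m d j"
          by (auto simp: in_keys_iff y split: if_splits)
        fix i assume i: "i \<in> block m d j"
        then have "real B * \<bar>lkp z i\<bar> \<le> real B * (1 / real B)"
          using z(2)[of i] by (intro mult_left_mono) (auto simp: block_def)
        then show "\<bar>lkp (y j) i\<bar> \<le> 1" using B0 i by (simp add: y abs_mult)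
      qed simp
      moreover have "signvec (block m d j) ` Pow (block m d j) \<subseteq> W" using that by (auto simp: W_def)
      ultimately show ?thesis using hull_mono by blast
    qed
    then have "(\<Sum>j<B. (1 / real B) *\<^sub>R y j) \<in> convex hull W"
      using B0 by (intro convex_sum convex_convex_hull) auto
    also have "(\<Sum>j<B. (1 / real B) *\<^sub>R y j) = z"
    proof (rule poly_mapping_eqI)
      fix k
      have "lkp (\<Sum>j<B. (1 / real B) *\<^sub>R y j) k
          = (\<Sum>j<B. if j = k div d then (if k < m then lkp z k else 0) else 0)"
        unfolding lookup_sum using B0 by (intro sum.cong) (auto simp: y block_def)
      also have "\<dots> = lkp z k"
        using blockB[of k] z(1) by (auto simp: Rn_iff)
      finally show "lkp (\<Sum>j<B. (1 / real B) *\<^sub>R y j) k = lkp z k" .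
    qed
    finally show "z \<in> convex hull W" .
  qed
qed

section \<open>The cube, for bounded \<open>n / m\<close>\<close>

text \<open>Fibres of the cube \<open>[- 1, 1] ^ n\<close> lie in cubes of side 2, whereas its
  difference body contains the cube of side 4 in \<open>F\<close>.\<close>

lemma large_difference_section_cube:
  assumes mn: "m < n" and a: "a \<le> 2" "a \<ge> 0"
  shows "large_difference_section m n a"
proof -
  define V where "V = signvec {..<n} ` Pow {..<n}"
  define K where "K = convex hull V"
  have cube: "z \<in> K" if "z \<in> Rn n" "\<And>i. i < n \<Longrightarrow> \<bar>lkp z i\<bar> \<le> 1" for z
    unfolding K_def V_def using that by (intro cube_subset_hull_signvec) (auto simp: Rn_def)
  have le: "\<bar>lkp z i\<bar> \<le> 1" if z: "z \<in> K" for z i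
  proof -
    have V1: "\<bar>lkp u i\<bar> \<le> 1" if "u \<in> V" for u
      using that by (auto simp: V_def lookup_signvec sgv_def)
    have "lkp z i \<le> 1"
    proof (rule hull_le_linear[OF linear_lookup])
      show "lkp u i \<le> 1" if "u \<in> V" for u using V1[OF that] by simp
      show "z \<in> convex hull V" using z by (simp add: K_def)
    qed
    moreover have "- lkp z i \<le> 1"
    proof (rule hull_le_linear[OF linear_compose_neg[OF linear_lookup]])
      show "- lkp u i \<le> 1" if "u \<in> V" for u using V1[OF that] by simp
      show "z \<in> convex hull V" using z by (simp add: K_def)
    qed
    ultimately show ?thesis by simp
  qed
  show ?thesis
  proof (rule large_difference_section_coordinates[where q = 2 and r = 2])
    show "convex_body n K"
      unfolding K_def
    proof (rule convex_body_hull)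
      show "finite V" by (simp add: V_def)
      show "V \<subseteq> Rn n" by (auto simp: V_def Rn_iff lookup_signvec)
      show "n > 0" using mn by simp
      fix i assume "i < n"
      then have u: "unitv i \<in> Rn n" by (rule unitv_Rn)
      then have "- unitv i \<in> Rn n" by (rule subspace_neg[OF subspace_Rn])
      then have "unitv i \<in> K" "- unitv i \<in> K"
        using u by (auto intro!: cube simp: lookup_unitv)
      then show "\<exists>c. \<exists>\<epsilon>>0. c + \<epsilon> *\<^sub>R unitv i \<in> convex hull V \<and> c - \<epsilon> *\<^sub>R unitv i \<in> convex hull V"
        by (intro exI[of _ 0] exI[of _ 1]) (simp add: K_def)
    qed
    show "m < n" "a \<ge> 0" by (rule mn a)+
    show "(2::real) \<ge> 0" by simp
    show "a * 2 \<le> 2 * 2" using a by auto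
  next
    fix z assume z: "z \<in> Rn m" "\<And>i. i < m \<Longrightarrow> \<bar>lkp z i\<bar> \<le> 2"
    have "z \<in> Rn n" using z(1) Rn_mono[of m n] mn by auto
    then have h: "(1/2) *\<^sub>R z \<in> Rn n" by (rule subspace_scale[OF subspace_Rn])
    then have h': "- ((1/2) *\<^sub>R z) \<in> Rn n" by (rule subspace_neg[OF subspace_Rn])
    have "\<bar>lkp z i\<bar> \<le> 2" for i
      using z by (cases "i < m") (auto simp: Rn_iff)
    then have "(1/2) *\<^sub>R z \<in> K" "- ((1/2) *\<^sub>R z) \<in> K"
      using h h' by (auto intro!: cube simp: mult.commute)
    moreover have "z = (1/2) *\<^sub>R z - - ((1/2) *\<^sub>R z)"
      by (simp flip: scaleR_add_left)
    ultimately show "z \<in> difference_body K" unfolding difference_body_def by blast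
  next
    fix x assume "x \<in> Rn n"
    let ?X = "\<Pi>\<^sub>E i\<in>{..<m}. {- 1 - lkp x i..1 - lkp x i}"
    show "\<exists>X\<in>sets (lebP {..<m}). emeasure (lebP {..<m}) X \<le> ennreal (2 ^ m) \<and>
        (\<forall>t\<in>space (lebP {..<m}). (\<Sum>i<m. t i *\<^sub>R unitv i) + x \<in> K \<longrightarrow> t \<in> X)"
    proof (intro bexI[of _ ?X] conjI ballI impI)
      show "?X \<in> sets (lebP {..<m})" by (intro sets_PiM_I_finite) auto
      show "emeasure (lebP {..<m}) ?X \<le> ennreal (2 ^ m)"
        by (subst emeasure_lebP_box) auto
      fix t assume t: "t \<in> space (lebP {..<m})" "(\<Sum>i<m. t i *\<^sub>R unitv i) + x \<in> K"
      have "t i \<in> {- 1 - lkp x i..1 - lkp x i}" if "i < m" for i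
        using le[OF t(2), of i] that by (simp add: lookup_add lookup_sum_unitv abs_le_iff)
      then show "t \<in> ?X"
        using t(1) by (simp add: space_PiM PiE_iff)
    qed
  qed simp
qed

section \<open>Choice of the block length\<close>

text \<open>For \<open>m \<le> d0\<close> the term \<open>sqrt m\<close> of the minimum serves;
  otherwise the logarithm does, being at most \<open>4 * d0\<close>.\<close>

lemma psi_le_of_block_length:
  assumes m: "1 \<le> m" and d0: "1 \<le> d0" and n: "n div m \<le> 2 ^ (d0 + 2)"
  shows "\<psi> m n \<le> 2 * sqrt (real (min m d0))"
proof (cases "m \<le> d0")
  case True
  have "\<psi> m n \<le> sqrt (real m)" by (simp add: \<psi>_def)
  also have "\<dots> \<le> 2 * sqrt (real m)" by simp
  finally show ?thesis using True by simp
next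
  case False
  have "real n < (real (n div m) + 1) * real m"
    using m dividend_less_div_times[of m n] by (simp add: algebra_simps flip: of_nat_mult of_nat_add)
  then have "real n / real m < real (n div m) + 1"
    using m by (simp add: divide_less_eq)
  also have "real (n div m) \<le> 2 ^ (d0 + 2)"
    using n by (metis of_nat_le_iff of_nat_numeral of_nat_power)
  finally have "real n / real m + 1 \<le> 2 ^ (d0 + 2) + 2" by simp
  \<comment> \<open>The 2 left over from rounding the quotient and from the summand 1 inside the
    logarithm is absorbed by doubling the power.\<close>
  also have "\<dots> \<le> 2 ^ (d0 + 3)"
  proof -
    have "(2::real) ^ (d0 + 2) = 4 * 2 ^ d0" "(2::real) ^ (d0 + 3) = 8 * 2 ^ d0"
      by (simp_all add: power_add)
    moreover have "1 \<le> (2::real) ^ d0" by simp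
    ultimately show ?thesis by linarith
  qed
  finally have "ln (real n / real m + 1) \<le> ln (2 ^ (d0 + 3))"
    by (subst ln_le_cancel_iff) (auto intro: add_nonneg_pos)
  also have "\<dots> = real (d0 + 3) * ln 2" by (simp add: ln_realpow)
  also have "\<dots> \<le> real (d0 + 3) * 1" using ln_2_less_1 by (intro mult_left_mono) auto
  also have "\<dots> \<le> 4 * real d0" using d0 by simp
  finally have "sqrt (ln (real n / real m + 1)) \<le> sqrt (4 * real d0)" by simp
  also have "\<dots> = 2 * sqrt (real d0)" by (simp add: real_sqrt_mult)
  finally show ?thesis using False by (simp add: \<psi>_def min_le_iff_disj)
qed

theorem theorem2:
  shows "\<exists>C::real. C > 0 \<and>
    (\<forall>m n :: nat. 1 \<le> m \<and> m < n \<longrightarrow>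
      (\<exists>K F :: (nat \<Rightarrow>\<^sub>0 real) set.
         convex_body n K \<and> F \<subseteq> Rn n \<and> subspace F \<and> dim F = m \<and>
         (\<forall>x\<in>Rn n.
            vol F 0 (difference_body K \<inter> F) \<ge> C ^ m * \<psi> m n ^ m * vol F x (K \<inter> {y + x | y. y \<in> F}))))"
proof (intro exI[of _ "1/6"] conjI allI impI)
  show "(1/6 :: real) > 0" by simp
  fix m n :: nat assume "1 \<le> m \<and> m < n"
  then have m: "1 \<le> m" and mn: "m < n" by auto
  have \<psi>0: "\<psi> m n \<ge> 0" by (simp add: \<psi>_def)
  have "large_difference_section m n (1/6 * \<psi> m n)"
  proof (cases "n div m < 5")
    case True
    \<comment> \<open>Here \<open>n div m \<le> 4\<close>, so \<open>d0 = 1\<close> is admissible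
      and \<open>\<psi>\<close> is at most 2.\<close>
    then have "\<psi> m n \<le> 2 * sqrt (real (min m 1))"
      using m by (intro psi_le_of_block_length) auto
    moreover have "min m 1 = 1" using m by simp
    ultimately have "1/6 * \<psi> m n \<le> 2" by simp
    with \<psi>0 show "large_difference_section m n (1/6 * \<psi> m n)"
      by (intro large_difference_section_cube[OF mn]) auto
  next
    case False
    define L where "L = n div m"
    have L: "L \<ge> 5" using False by (simp add: L_def)
    \<comment> \<open>\<open>F\<close> takes \<open>m\<close> of at least \<open>m * L\<close>
      coordinates, which leaves \<open>m * (L - 1)\<close> for the vertices; \<open>2 ^ k\<close> is
      the largest power of two up to \<open>L - 1\<close>.\<close>
    obtain k where k: "2 ^ k \<le> L - 1" "L - 1 < 2 ^ (k + 1)"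
    proof -
      have "1 \<le> L - 1" using L by simp
      then show thesis using ex_power_ivl1[of 2 "L - 1"] that by blast
    qed
    have "k \<ge> 2"
    proof (rule ccontr)
      assume "\<not> k \<ge> 2"
      then have "2 ^ (k + 1) \<le> (2::nat) ^ 2" by (intro power_increasing) auto
      then show False using k(2) L by simp
    qed
    \<comment> \<open>One power of two pays for the factor 2 in
      \<open>B \<le> 2 * m\<close>.\<close>
    define d0 where "d0 = k - 1"
    have d0: "1 \<le> d0" "k = d0 + 1" using \<open>k \<ge> 2\<close> by (auto simp: d0_def)
    define d where "d = min m d0"
    have d: "1 \<le> d" "d \<le> m" "d \<le> d0" using m d0 by (auto simp: d_def)
    define B where "B = (m - 1) div d + 1"
    \<comment> \<open>Rounding the number of blocks up costs at most a factor 2, as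
      \<open>d \<le> m\<close>.\<close>
    have "B * d \<le> (m - 1) + d"
      using div_times_less_eq_dividend[of "m - 1" d] by (simp add: B_def algebra_simps)
    then have Bd: "B * d \<le> 2 * m" using d by linarith
    have "B \<le> B * d" using d by simp
    then have "B \<le> 2 * m" using Bd by linarith
    then have "B * 2 ^ d \<le> 2 * m * 2 ^ d0"
      using d by (intro mult_le_mono power_increasing) auto
    also have "\<dots> = m * 2 ^ k" by (simp add: d0)
    also have "\<dots> \<le> m * (L - 1)" using k by simp
    finally have "B * 2 ^ d \<le> m * (L - 1)" .
    moreover have "m + m * (L - 1) = m * L" using L by (cases L) auto
    ultimately have "m + B * 2 ^ d \<le> m * L" by linarith
    also have "\<dots> \<le> n" unfolding L_def by (metis div_times_less_eq_dividend mult.commute)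
    finally have n: "m + B * 2 ^ d \<le> n" .
    have "L \<le> 2 ^ (d0 + 2)" using k(2) by (simp add: d0)
    then have \<psi>: "\<psi> m n \<le> 2 * sqrt (real d)"
      unfolding d_def L_def using m d0 by (intro psi_le_of_block_length) auto
    \<comment> \<open>The constant \<open>1/6\<close> comes from here: with
      \<open>exp 1 \<le> 3\<close> and \<open>\<psi> m n \<le> 2 * sqrt d\<close> the product is at
      most \<open>2 * d / m\<close>, and \<open>B * d \<le> 2 * m\<close> bounds this by
      \<open>4 / B\<close>.\<close>
    have "1/6 * \<psi> m n * (2 * exp 1 * sqrt (real d) / real m)
        \<le> 1/6 * (2 * sqrt (real d)) * (2 * 3 * sqrt (real d) / real m)"
      using \<psi> \<psi>0 exp_le by (intro mult_mono divide_right_mono) auto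
    also have "\<dots> = 2 * real d / real m" by simp
    also have "\<dots> \<le> 4 / real B"
    proof -
      have "real B * real d \<le> 2 * real m"
        using Bd by (metis of_nat_le_iff of_nat_mult of_nat_numeral)
      moreover have "real B > 0" by (simp add: B_def)
      ultimately show ?thesis using m by (simp add: field_simps)
    qed
    finally show "large_difference_section m n (1/6 * \<psi> m n)"
      using \<psi>0 by (intro large_difference_section_blocks[OF m d(1) B_def n]) auto
  qed
  then show "\<exists>K F :: (nat \<Rightarrow>\<^sub>0 real) set.
         convex_body n K \<and> F \<subseteq> Rn n \<and> subspace F \<and> dim F = m \<and>
         (\<forall>x\<in>Rn n.
            vol F 0 (difference_body K \<inter> F) \<ge> (1/6) ^ m * \<psi> m n ^ m * vol F x (K \<inter> {y + x | y. y \<in> F}))"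
    unfolding large_difference_section_def power_mult_distrib .
qed

end
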